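(* Let $p\geq 2$ and suppose that the sequence $f_n=n^pa_n$ ($n=0,1,2,\ldots$), $a_n$ being the coefficients of the Legendre expansion $\frac{1}{4\pi}\sum_{n=0}^\infty(2n+1)a_nP_n(\cos u)$, satisfies the Hausdorff-type condition: there exist constants $M>0$ and $\epsilon>0$ with $$(n+1)^{(1+\epsilon)}\sum_{i=0}^n \binom{n}{i}^{(2+\epsilon)} \left|\Delta^i f_{n-i}\right|^{(2+\epsilon)} < M \qquad (n=0,1,2,\ldots).$$ Then the jump function $F(v)=\underline{F}(\cosh v)$ admits the integral representation $$F(v)=\underline{F}(\cosh v)=\frac{1}{4\pi}\int_{-\infty}^{+\infty}\tilde a(\sigma+i\nu)\,h(\sigma+i\nu)\,P_{\sigma+i\nu}(\cosh v)\,d\nu\qquad\left(\sigma\geq-\tfrac12\right),$$ where $h(\sigma+i\nu)=2(\sigma+i\nu)+1$, and $P_{\sigma+i\nu}(\cosh v)$ denotes the first-kind Legendre functions.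
   Context: $P_n$ denotes the Legendre polynomials. $\Delta$ is the difference operator $\Delta f_n=f_{n+1}-f_n$, with $\Delta^0$ the identity and $\Delta^k f_n=\sum_{m=0}^k(-1)^m\binom{k}{m}f_{n+k-m}$; the numbers $f_n$ are real. Under the hypothesis the Legendre expansion converges for $|\cos u|<1$ to a function $\underline{f}(\cos u)$ which extends holomorphically to the complex $\cos\theta$-plane ($\theta=u+iv$) cut along $[1,+\infty)$; put $f(\theta)=\underline{f}(\cos\theta)$. The boundary values are $f_\pm(v)=\lim_{u\to0^+}f(\pm u+iv)$ for $v\ge0$ and the jump function is $F(v)=\underline{F}(\cosh v)=i[f_+(v)-f_-(v)]$. $\tilde a(\lambda)$ is the Carlsonian interpolation of the $a_n$: the function holomorphic in $\mathrm{Re}\,\lambda>-1/2$, continuous at $\mathrm{Re}\,\lambda=-1/2$, with $\tilde a(n)=a_n$ ($n=0,1,2,\ldots$) and $\lambda^p\tilde a(\lambda)$ in the Hardy space $\mathbb{H}^2$ of the half-plane $\mathrm{Re}\,\lambda>-1/2$; it is unique by Carlson's theorem. *)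

theory Defs
  imports "HOL-Complex_Analysis.Complex_Analysis"
begin

definition fdiff :: "(nat \<Rightarrow> real) \<Rightarrow> nat \<Rightarrow> real" where
  "fdiff f n = f (Suc n) - f n"

abbreviation fdiff_iter :: "nat \<Rightarrow> (nat \<Rightarrow> real) \<Rightarrow> nat \<Rightarrow> real" where
  "fdiff_iter k f n \<equiv> (fdiff ^^ k) f n"

lemma fdiff_iter_closed_form:
  "fdiff_iter k f n = (\<Sum>m=0..k. (-1) ^ m * real (k choose m) * f (n + k - m))"
proof (induction k arbitrary: n)
  case 0
  then show ?case by simp
next
  case (Suc k)
  let ?c = "\<lambda>m. (-1) ^ m * real (k choose m) * f (Suc n + k - m)"
  let ?d = "\<lambda>m. (-1) ^ m * real (k choose m) * f (n + k - m)"
  let ?e = "\<lambda>m. (-1) ^ m * real (Suc k choose m) * f (n + Suc k - m)"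
  have "sum ?e {0..Suc k} = f (n + Suc k) + (\<Sum>m=0..k. ?e (Suc m))"
    unfolding sum.atLeast0_atMost_Suc_shift by simp
  also have "(\<Sum>m=0..k. ?e (Suc m)) =
      (\<Sum>m=0..k. - ?d m + (-1) ^ Suc m * real (k choose Suc m) * f (n + k - m))"
    by (rule sum.cong) (auto simp: algebra_simps)
  also have "\<dots> = - sum ?d {0..k} +
      (\<Sum>m=0..k. (-1) ^ Suc m * real (k choose Suc m) * f (n + k - m))"
    by (simp only: sum.distrib sum_negf)
  also have "f (n + Suc k) + \<dots> = sum ?c {0..Suc k} - sum ?d {0..k}"
    unfolding sum.atLeast0_atMost_Suc_shift by simp
  also have "sum ?c {0..Suc k} = sum ?c {0..k}"
    by simp
  finally have "sum ?e {0..Suc k} = sum ?c {0..k} - sum ?d {0..k}" .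
  moreover have "fdiff_iter (Suc k) f n = fdiff_iter k f (Suc n) - fdiff_iter k f n"
    by (simp add: fdiff_def)
  ultimately show ?case using Suc.IH[of "Suc n"] Suc.IH[of n] by simp
qed

definition hausdorff_condition :: "(nat \<Rightarrow> real) \<Rightarrow> bool" where
  "hausdorff_condition f \<longleftrightarrow>
     (\<exists>M>0. \<exists>\<epsilon>>0. \<forall>n.
        real (n + 1) powr (1 + \<epsilon>) *
          (\<Sum>i=0..n. real (n choose i) powr (2 + \<epsilon>) * \<bar>fdiff_iter i f (n - i)\<bar> powr (2 + \<epsilon>)) < M)"

(* Rodrigues' formula. *)
definition legendre_poly :: "nat \<Rightarrow> real poly" where
  "legendre_poly n = smult (1 / (2 ^ n * fact n)) ((pderiv ^^ n) ([:-1, 0, 1:] ^ n))"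

(* Laplace's first integral for the Legendre function of the first kind, used only for real
   x \<ge> 1. There the base of the power is at least x - sqrt (x^2 - 1) > 0, so powr is the
   unambiguous power exp (lam * ln _), and the formula holds for every complex degree lam. *)
definition legendre_fn :: "complex \<Rightarrow> real \<Rightarrow> complex" where
  "legendre_fn lam x =
     1 / of_real pi *
       integral {0..pi} (\<lambda>\<phi>. complex_of_real (x + sqrt (x\<^sup>2 - 1) * cos \<phi>) powr lam)"

definition hardy2_halfplane :: "real \<Rightarrow> (complex \<Rightarrow> complex) \<Rightarrow> bool" where
  "hardy2_halfplane c g \<longleftrightarrow>
     g holomorphic_on {z. Re z > c} \<and>
     (SUP \<sigma>\<in>{c<..}. \<integral>\<^sup>+\<nu>. ennreal ((cmod (g (Complex \<sigma> \<nu>)))\<^sup>2) \<partial>lborel) < \<infinity>"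

definition carlsonian_interpolation ::
    "nat \<Rightarrow> (nat \<Rightarrow> real) \<Rightarrow> (complex \<Rightarrow> complex) \<Rightarrow> bool" where
  "carlsonian_interpolation p a A \<longleftrightarrow>
     A holomorphic_on {z. Re z > -1/2} \<and>
     continuous_on {z. Re z \<ge> -1/2} A \<and>
     (\<forall>n. A (of_nat n) = of_real (a n)) \<and>
     hardy2_halfplane (-1/2) (\<lambda>z. z ^ p * A z)"

definition cut_plane :: "complex set" where
  "cut_plane = - (complex_of_real ` {1..})"

(* By the identity theorem g is determined on the cut plane by a; its values on the cut
   are irrelevant. *)
definition legendre_extension :: "(nat \<Rightarrow> real) \<Rightarrow> (complex \<Rightarrow> complex) \<Rightarrow> bool" where
  "legendre_extension a g \<longleftrightarrow>
     g holomorphic_on cut_plane \<and>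
     (\<forall>u::real. \<bar>cos u\<bar> < 1 \<longrightarrow>
        (\<lambda>n. complex_of_real
               (1 / (4 * pi) * (real (2 * n + 1) * a n * poly (legendre_poly n) (cos u))))
          sums g (of_real (cos u)))"

definition boundary_plus :: "(complex \<Rightarrow> complex) \<Rightarrow> real \<Rightarrow> complex" where
  "boundary_plus g v = Lim (at_right 0) (\<lambda>u. g (cos (Complex u v)))"

definition boundary_minus :: "(complex \<Rightarrow> complex) \<Rightarrow> real \<Rightarrow> complex" where
  "boundary_minus g v = Lim (at_right 0) (\<lambda>u. g (cos (Complex (- u) v)))"

definition jump_function :: "(complex \<Rightarrow> complex) \<Rightarrow> real \<Rightarrow> complex" where
  "jump_function g v = \<i> * (boundary_plus g v - boundary_minus g v)"

end

theory Submission imports Defs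
begin

text \<open>
  The idea is to reduce the Legendre expansion to a power series. Put b(\<lambda>) = (2\<lambda> + 1) A(\<lambda>) / (4\<pi>) and let
  G(w) be the sum of b(n) w^n. By Laplace's integral
  P_n(z) = (1/\<pi>) \<integral> (z + s cos \<phi>)^n d\<phi> over [0, \<pi>], with s^2 = z^2 - 1,
  the Legendre expansion is the mean of G(z + s cos \<phi>) over \<phi>. Analytic continuation, boundary
  values and the jump are therefore all inherited from G, and Legendre functions of complex
  argument never appear: the function P_\<lambda>(cosh v) of the statement is the same mean of the power
  function.

  For G the continuation is given by the Mellin-Barnes integral
  -(1/2) \<integral> b(\<lambda>) (-w)^\<lambda> / sin (\<pi>\<lambda>) d\<nu> along a line \<lambda> = -1/4 + i\<nu>. The kernel is bounded for
  |arg (-w)| \<le> \<pi>, so the integral is analytic off [0, \<infinity>) and continuous up to both sides of (0, \<infinity>) as soon as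
  b is integrable on vertical lines, which follows from the Hardy space hypothesis with p \<ge> 2
  (hardy_line_bound). Shifting the line to the right past the poles 0, 1, 2, \<dots> shows that the
  integral equals the power series for |w| \<le> 1 (mb_integral_step, mb_eq_series); the series converges
  on the closed disc by the Hausdorff condition (hausdorff_summable). On the two sides of the ray the values of
  (-w)^\<lambda> are r^\<lambda> e^(-i\<pi>\<lambda>) and r^\<lambda> e^(i\<pi>\<lambda>); the difference contains the factor sin (\<pi>\<lambda>), which
  cancels the denominator, so that the jump of G at r is, up to a factor i or -i, the integral of
  b(\<lambda>) r^\<lambda> over the line (mb_jump).

  The points z + s cos \<phi> avoid [1, \<infinity>) when z does (laplace_segment_in_cut_plane). As z = cos (u + iv) tends to
  cosh v they tend to r = cosh v + sinh v cos \<phi>, and whenever r \<ge> 1 they approach the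
  cut from the side determined by the sign of u (series_ext_boundary_limit). Dominated convergence
  and Fubini's theorem then give the representation on one line, and a Cauchy theorem for strips that
  needs only integral bounds (line_integral_shift) carries it to all lines Re \<lambda> \<ge> -1/2.
\<close>

section \<open>Integrals along vertical lines\<close>

lemma integrable_of_tail_bound:
  fixes f :: "real \<Rightarrow> complex"
  assumes cont: "continuous_on UNIV f"
    and tail: "(\<integral>\<^sup>+x. indicator {x. 1 \<le> \<bar>x\<bar>} x * ennreal (cmod (f x)) \<partial>lborel) < \<infinity>"
  shows "integrable lborel f"
proof -
  have meas [measurable]: "f \<in> borel_measurable borel"
    using cont by (rule borel_measurable_continuous_onI)
  have "set_integrable lborel {-1..1} f"
    unfolding set_integrable_def
    by (intro borel_integrable_compact) (auto intro: continuous_on_subset[OF cont])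
  moreover have "set_integrable lborel {x. 1 \<le> \<bar>x\<bar>} f"
    unfolding set_integrable_def integrable_iff_bounded
  proof
    show "(\<integral>\<^sup>+x. ennreal (norm (indicat_real {x. 1 \<le> \<bar>x\<bar>} x *\<^sub>R f x)) \<partial>lborel) < \<infinity>"
      using tail by (simp add: ennreal_mult ennreal_indicator)
  qed measurable
  ultimately have "set_integrable lborel ({-1..1} \<union> {x. 1 \<le> \<bar>x\<bar>}) f"
    by (rule set_integrable_Un) auto
  also have "{-1..1} \<union> {x. 1 \<le> \<bar>x\<bar>} = (UNIV :: real set)" by auto
  finally show ?thesis by (simp add: set_integrable_def)
qed

lemma tendsto_symmetric_integral:
  fixes f :: "real \<Rightarrow> complex"
  assumes "integrable lborel f"
  shows "((\<lambda>T. LINT x|lborel. indicator {-T..T} x *\<^sub>R f x) \<longlongrightarrow> (LINT x|lborel. f x)) at_top"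
proof (rule integral_dominated_convergence_at_top)
  show "f \<in> borel_measurable lborel" "integrable lborel (\<lambda>x. norm (f x))" using assms by auto
  show "(\<lambda>x. indicat_real {- T..T} x *\<^sub>R f x) \<in> borel_measurable lborel" for T
    using assms by measurable
  show "\<forall>\<^sub>F T in at_top. AE x in lborel. norm (indicat_real {- T..T} x *\<^sub>R f x) \<le> norm (f x)"
    by (intro always_eventually allI AE_I2) (auto simp: indicator_def)
  show "AE x in lborel. ((\<lambda>T. indicat_real {- T..T} x *\<^sub>R f x) \<longlongrightarrow> f x) at_top"
  proof (rule AE_I2, rule tendsto_eventually)
    show "\<forall>\<^sub>F T in at_top. indicat_real {- T..T} x *\<^sub>R f x = f x" for x
      using eventually_ge_at_top[of "\<bar>x\<bar>"] by eventually_elim (auto simp: indicator_def)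
  qed
qed

text \<open>
  Cauchy's theorem for an infinite strip, with an integral bound in place of pointwise decay at
  the ends. A primitive of \<Phi> turns the difference of the two truncated line integrals into the
  difference of two horizontal segments, at heights T and -T, and these are bounded by h T and h (-T),
  where h is the integral of the norm of \<Phi> across the strip. By Tonelli h is integrable over
  |T| \<ge> 1, so h T + h (-T) cannot stay above a positive constant, and a limit of the
  differences as T tends to infinity must be 0. The line bounds are only required on |\<nu>| \<ge> 1,
  so that singularities removed near the real axis do no harm.
\<close>

lemma line_integral_shift:
  fixes \<Phi> :: "complex \<Rightarrow> complex"
  assumes less: "\<sigma>1 < \<sigma>2"
    and cont: "continuous_on {z. \<sigma>1 \<le> Re z \<and> Re z \<le> \<sigma>2} \<Phi>"
    and holo: "\<Phi> holomorphic_on {z. \<sigma>1 < Re z \<and> Re z < \<sigma>2}"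
    and tail: "\<And>\<sigma>. \<sigma>1 \<le> \<sigma> \<Longrightarrow> \<sigma> \<le> \<sigma>2 \<Longrightarrow>
      (\<integral>\<^sup>+\<nu>. indicator {\<nu>. 1 \<le> \<bar>\<nu>\<bar>} \<nu> * ennreal (cmod (\<Phi> (Complex \<sigma> \<nu>))) \<partial>lborel) \<le> ennreal B"
  shows "(LINT \<nu>|lborel. \<Phi> (Complex \<sigma>1 \<nu>)) = (LINT \<nu>|lborel. \<Phi> (Complex \<sigma>2 \<nu>))"
proof -
  define S where "S = {z. \<sigma>1 \<le> Re z \<and> Re z \<le> \<sigma>2}"
  have S_alt: "S = {z. \<sigma>1 \<le> Re z} \<inter> {z. Re z \<le> \<sigma>2}" by (auto simp: S_def)
  have convex: "convex S"
    unfolding S_alt by (intro convex_Int convex_halfspace_Re_ge convex_halfspace_Re_le)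
  have "interior S = {z. \<sigma>1 < Re z} \<inter> {z. Re z < \<sigma>2}"
    unfolding S_alt by (simp add: interior_halfspace_ge[of "1::complex", simplified] interior_Int)
       (use interior_halfspace_ge[of "1::complex" \<sigma>1] interior_halfspace_le[of "1::complex" \<sigma>2] in simp)
  then have int: "interior S = {z. \<sigma>1 < Re z \<and> Re z < \<sigma>2}" by auto
  obtain \<Psi> where \<Psi>: "\<And>x. x \<in> S \<Longrightarrow> (\<Psi> has_field_derivative \<Phi> x) (at x within S)"
    using holomorphic_convex_primitive[OF convex finite.emptyI cont[folded S_def]] holo int
    by (metis Diff_empty holomorphic_on_imp_differentiable_at open_interior)
  have lineC: "continuous_on UNIV (\<lambda>\<nu>. \<Phi> (Complex \<sigma> \<nu>))" if "\<sigma>1 \<le> \<sigma>" "\<sigma> \<le> \<sigma>2" for \<sigma>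
    unfolding Complex_eq
    by (rule continuous_on_compose2[OF cont]) (use that in \<open>auto intro!: continuous_intros\<close>)
  have horC: "continuous_on {\<sigma>1..\<sigma>2} (\<lambda>\<sigma>. \<Phi> (Complex \<sigma> \<nu>))" for \<nu>
    unfolding Complex_eq
    by (rule continuous_on_compose2[OF cont]) (auto intro!: continuous_intros)
  have vert: "\<i> * (LINT \<nu>|lborel. indicator {-T..T} \<nu> *\<^sub>R \<Phi> (Complex \<sigma> \<nu>))
      = \<Psi> (Complex \<sigma> T) - \<Psi> (Complex \<sigma> (-T))" if "\<sigma>1 \<le> \<sigma>" "\<sigma> \<le> \<sigma>2" "0 \<le> T" for \<sigma> T
  proof -
    have "(LINT \<nu>|lborel. indicator {-T..T} \<nu> *\<^sub>R (\<i> * \<Phi> (Complex \<sigma> \<nu>)))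
        = \<Psi> (Complex \<sigma> T) - \<Psi> (Complex \<sigma> (-T))"
    proof (rule integral_FTC_Icc)
      show "-T \<le> T" using that by simp
      show "continuous_on {-T..T} (\<lambda>\<nu>. \<i> * \<Phi> (Complex \<sigma> \<nu>))"
        by (intro continuous_intros continuous_on_subset[OF lineC]) (use that in auto)
      fix \<nu> assume "-T \<le> \<nu>" "\<nu> \<le> T"
      have 1: "((\<lambda>\<nu>. Complex \<sigma> \<nu>) has_vector_derivative \<i>) (at \<nu> within {-T..T})"
        unfolding Complex_eq by (auto intro!: derivative_eq_intros)
      have 2: "(\<Psi> has_field_derivative \<Phi> (Complex \<sigma> \<nu>)) (at (Complex \<sigma> \<nu>) within Complex \<sigma> ` {-T..T})"
        by (rule DERIV_subset[OF \<Psi>]) (use that in \<open>auto simp: S_def\<close>)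
      show "((\<lambda>\<nu>. \<Psi> (Complex \<sigma> \<nu>)) has_vector_derivative \<i> * \<Phi> (Complex \<sigma> \<nu>)) (at \<nu> within {-T..T})"
        using field_vector_diff_chain_within[OF 1 2] by (simp add: o_def)
    qed
    moreover have "indicator {-T..T} \<nu> *\<^sub>R (\<i> * \<Phi> (Complex \<sigma> \<nu>)) = \<i> * (indicator {-T..T} \<nu> *\<^sub>R \<Phi> (Complex \<sigma> \<nu>))" for \<nu>
      by (rule mult_scaleR_right[symmetric])
    ultimately show ?thesis by (simp only: integral_mult_right_zero)
  qed
  define h where "h T = (\<integral>\<^sup>+\<sigma>. indicator {\<sigma>1..\<sigma>2} \<sigma> * ennreal (cmod (\<Phi> (Complex \<sigma> T))) \<partial>lborel)" for T
  have hor: "ennreal (cmod (\<Psi> (Complex \<sigma>2 T) - \<Psi> (Complex \<sigma>1 T))) \<le> h T" for T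
  proof -
    have hb: "has_bochner_integral lborel (\<lambda>\<sigma>. indicator {\<sigma>1..\<sigma>2} \<sigma> *\<^sub>R \<Phi> (Complex \<sigma> T))
        (\<Psi> (Complex \<sigma>2 T) - \<Psi> (Complex \<sigma>1 T))"
    proof (rule has_bochner_integral_FTC_Icc)
      show "\<sigma>1 \<le> \<sigma>2" using less by simp
      show "continuous_on {\<sigma>1..\<sigma>2} (\<lambda>\<sigma>. \<Phi> (Complex \<sigma> T))" by (rule horC)
      fix \<sigma> assume "\<sigma>1 \<le> \<sigma>" "\<sigma> \<le> \<sigma>2"
      have 1: "((\<lambda>\<sigma>. Complex \<sigma> T) has_vector_derivative 1) (at \<sigma> within {\<sigma>1..\<sigma>2})"
        unfolding Complex_eq by (auto intro!: derivative_eq_intros)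
      have 2: "(\<Psi> has_field_derivative \<Phi> (Complex \<sigma> T)) (at (Complex \<sigma> T) within (\<lambda>\<sigma>. Complex \<sigma> T) ` {\<sigma>1..\<sigma>2})"
        by (rule DERIV_subset[OF \<Psi>]) (use \<open>\<sigma>1 \<le> \<sigma>\<close> \<open>\<sigma> \<le> \<sigma>2\<close> in \<open>auto simp: S_def\<close>)
      show "((\<lambda>\<sigma>. \<Psi> (Complex \<sigma> T)) has_vector_derivative \<Phi> (Complex \<sigma> T)) (at \<sigma> within {\<sigma>1..\<sigma>2})"
        using field_vector_diff_chain_within[OF 1 2] by (simp add: o_def)
    qed
    then have "ennreal (norm (\<Psi> (Complex \<sigma>2 T) - \<Psi> (Complex \<sigma>1 T))) \<le>
        (\<integral>\<^sup>+\<sigma>. norm (indicator {\<sigma>1..\<sigma>2} \<sigma> *\<^sub>R \<Phi> (Complex \<sigma> T)) \<partial>lborel)"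
      using integral_norm_bound_ennreal[of lborel "\<lambda>\<sigma>. indicator {\<sigma>1..\<sigma>2} \<sigma> *\<^sub>R \<Phi> (Complex \<sigma> T)"]
      by (simp add: has_bochner_integral_iff)
    then show ?thesis by (simp add: h_def ennreal_mult ennreal_indicator)
  qed
  have closed: "closed {p :: real \<times> real. \<sigma>1 \<le> fst p \<and> fst p \<le> \<sigma>2}"
    by (intro closed_Collect_conj closed_Collect_le continuous_intros)
  have "continuous_on {p :: real \<times> real. \<sigma>1 \<le> fst p \<and> fst p \<le> \<sigma>2} (\<lambda>p. \<Phi> (Complex (fst p) (snd p)))"
    unfolding Complex_eq
    by (rule continuous_on_compose2[OF cont]) (auto intro!: continuous_intros)
  then have "(\<lambda>p. indicator {p :: real \<times> real. \<sigma>1 \<le> fst p \<and> fst p \<le> \<sigma>2} p *\<^sub>R \<Phi> (Complex (fst p) (snd p)))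
      \<in> borel_measurable borel"
    using closed by (intro borel_measurable_continuous_on_indicator) auto
  then have meas1: "(\<lambda>p. ennreal (cmod (indicator {p :: real \<times> real. \<sigma>1 \<le> fst p \<and> fst p \<le> \<sigma>2} p *\<^sub>R \<Phi> (Complex (fst p) (snd p)))))
      \<in> borel_measurable borel"
    by measurable
  then have meas2 [measurable]: "(\<lambda>(\<sigma>,\<nu>). indicator {\<sigma>1..\<sigma>2} \<sigma> * ennreal (cmod (\<Phi> (Complex \<sigma> \<nu>))))
      \<in> borel_measurable (lborel \<Otimes>\<^sub>M lborel)"
  proof -
    have "ennreal (cmod (indicator {p :: real \<times> real. \<sigma>1 \<le> fst p \<and> fst p \<le> \<sigma>2} p *\<^sub>R \<Phi> (Complex (fst p) (snd p))))
        = (case p of (\<sigma>,\<nu>) \<Rightarrow> indicator {\<sigma>1..\<sigma>2} \<sigma> * ennreal (cmod (\<Phi> (Complex \<sigma> \<nu>))))" for p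
      by (auto simp: indicator_def split: prod.splits)
    then show ?thesis using meas1 by (simp only: lborel_prod measurable_lborel2)
  qed
  have hmeas [measurable]: "h \<in> borel_measurable lborel"
    unfolding h_def[abs_def] using meas2 by measurable
  have hfin: "(\<integral>\<^sup>+\<nu>. indicator {\<nu>. 1 \<le> \<bar>\<nu>\<bar>} \<nu> * h \<nu> \<partial>lborel) < \<infinity>"
  proof -
    have "(\<integral>\<^sup>+\<nu>. indicator {\<nu>. 1 \<le> \<bar>\<nu>\<bar>} \<nu> * h \<nu> \<partial>lborel)
      = (\<integral>\<^sup>+\<nu>. (\<integral>\<^sup>+\<sigma>. indicator {\<nu>. 1 \<le> \<bar>\<nu>\<bar>} \<nu> * (indicator {\<sigma>1..\<sigma>2} \<sigma> * ennreal (cmod (\<Phi> (Complex \<sigma> \<nu>)))) \<partial>lborel) \<partial>lborel)"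
      unfolding h_def using meas2 by (intro nn_integral_cong nn_integral_cmult[symmetric]) measurable
    also have "\<dots> = (\<integral>\<^sup>+\<sigma>. (\<integral>\<^sup>+\<nu>. indicator {\<nu>. 1 \<le> \<bar>\<nu>\<bar>} \<nu> * (indicator {\<sigma>1..\<sigma>2} \<sigma> * ennreal (cmod (\<Phi> (Complex \<sigma> \<nu>)))) \<partial>lborel) \<partial>lborel)"
      using meas2 by (intro lborel_pair.Fubini') measurable
    also have "\<dots> \<le> (\<integral>\<^sup>+\<sigma>. indicator {\<sigma>1..\<sigma>2} \<sigma> * ennreal B \<partial>lborel)"
    proof (rule nn_integral_mono)
      fix \<sigma>
      show "(\<integral>\<^sup>+\<nu>. indicator {\<nu>. 1 \<le> \<bar>\<nu>\<bar>} \<nu> * (indicator {\<sigma>1..\<sigma>2} \<sigma> * ennreal (cmod (\<Phi> (Complex \<sigma> \<nu>)))) \<partial>lborel)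
         \<le> indicator {\<sigma>1..\<sigma>2} \<sigma> * ennreal B"
        using tail[of \<sigma>] by (cases "\<sigma> \<in> {\<sigma>1..\<sigma>2}") auto
    qed
    also have "\<dots> = ennreal (\<sigma>2 - \<sigma>1) * ennreal B"
      using less by (subst nn_integral_multc) auto
    also have "\<dots> < \<infinity>" by (simp add: ennreal_mult_less_top)
    finally show ?thesis .
  qed
  let ?J = "\<lambda>\<sigma>. LINT \<nu>|lborel. \<Phi> (Complex \<sigma> \<nu>)"
  let ?I = "\<lambda>\<sigma> T. LINT \<nu>|lborel. indicator {-T..T} \<nu> *\<^sub>R \<Phi> (Complex \<sigma> \<nu>)"
  have lint: "integrable lborel (\<lambda>\<nu>. \<Phi> (Complex \<sigma> \<nu>))" if "\<sigma>1 \<le> \<sigma>" "\<sigma> \<le> \<sigma>2" for \<sigma>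
    by (rule integrable_of_tail_bound[OF lineC[OF that]])
       (use tail[OF that] in \<open>auto intro: le_less_trans\<close>)
  have lim: "((\<lambda>T. ?I \<sigma>2 T - ?I \<sigma>1 T) \<longlongrightarrow> ?J \<sigma>2 - ?J \<sigma>1) at_top"
    using less by (intro tendsto_diff tendsto_symmetric_integral lint) auto
  have est: "ennreal (cmod (?I \<sigma>2 T - ?I \<sigma>1 T)) \<le> h T + h (-T)" if "0 \<le> T" for T
  proof -
    have rot: "\<i> * (?I \<sigma>2 T - ?I \<sigma>1 T) = (\<Psi> (Complex \<sigma>2 T) - \<Psi> (Complex \<sigma>1 T)) - (\<Psi> (Complex \<sigma>2 (-T)) - \<Psi> (Complex \<sigma>1 (-T)))"
      using vert[of \<sigma>1 T] vert[of \<sigma>2 T] less that by (simp add: right_diff_distrib)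
    have "cmod (?I \<sigma>2 T - ?I \<sigma>1 T) = cmod (\<i> * (?I \<sigma>2 T - ?I \<sigma>1 T))"
      by (simp only: norm_mult norm_ii mult_1)
    also have "\<dots> = cmod ((\<Psi> (Complex \<sigma>2 T) - \<Psi> (Complex \<sigma>1 T)) - (\<Psi> (Complex \<sigma>2 (-T)) - \<Psi> (Complex \<sigma>1 (-T))))"
      by (simp only: rot)
    also have "\<dots> \<le> cmod (\<Psi> (Complex \<sigma>2 T) - \<Psi> (Complex \<sigma>1 T)) + cmod (\<Psi> (Complex \<sigma>2 (-T)) - \<Psi> (Complex \<sigma>1 (-T)))"
      by (rule norm_triangle_ineq4)
    finally have "ennreal (cmod (?I \<sigma>2 T - ?I \<sigma>1 T)) \<le> ennreal (cmod (\<Psi> (Complex \<sigma>2 T) - \<Psi> (Complex \<sigma>1 T))) + ennreal (cmod (\<Psi> (Complex \<sigma>2 (-T)) - \<Psi> (Complex \<sigma>1 (-T))))"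
      by (simp only: ennreal_plus[symmetric] norm_ge_zero ennreal_leI)
    also have "\<dots> \<le> h T + h (-T)" by (intro add_mono hor)
    finally show ?thesis .
  qed
  have "?J \<sigma>2 - ?J \<sigma>1 = 0"
  proof (rule ccontr)
    assume neq: "?J \<sigma>2 - ?J \<sigma>1 \<noteq> 0"
    define e where "e = cmod (?J \<sigma>2 - ?J \<sigma>1) / 2"
    have e: "0 < e" using neq by (simp add: e_def)
    have "\<forall>\<^sub>F T in at_top. e < cmod (?I \<sigma>2 T - ?I \<sigma>1 T)"
      by (rule order_tendstoD(1)[OF tendsto_norm[OF lim]]) (use e in \<open>simp add: e_def\<close>)
    then obtain T0 where T0: "\<And>T. T \<ge> T0 \<Longrightarrow> e < cmod (?I \<sigma>2 T - ?I \<sigma>1 T)"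
      by (auto simp: eventually_at_top_linorder)
    define T1 where "T1 = max 1 T0"
    \<comment> \<open>A nonzero limit would keep h T + h (-T) above a fixed e on a half-line of infinite measure.\<close>
    have "(\<integral>\<^sup>+T. ennreal e * indicator {T1..} T \<partial>lborel) \<le>
      (\<integral>\<^sup>+T. indicator {\<nu>. 1 \<le> \<bar>\<nu>\<bar>} T * h T + indicator {\<nu>. 1 \<le> \<bar>\<nu>\<bar>} (-T) * h (-T) \<partial>lborel)"
    proof (rule nn_integral_mono)
      fix T
      show "ennreal e * indicator {T1..} T \<le> indicator {\<nu>. 1 \<le> \<bar>\<nu>\<bar>} T * h T + indicator {\<nu>. 1 \<le> \<bar>\<nu>\<bar>} (-T) * h (-T)"
      proof (cases "T1 \<le> T")
        case True
        then have "ennreal e \<le> ennreal (cmod (?I \<sigma>2 T - ?I \<sigma>1 T))"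
          using T0[of T] by (intro ennreal_leI less_imp_le) (simp add: T1_def)
        also have "\<dots> \<le> h T + h (-T)" using True by (intro est) (simp add: T1_def)
        finally show ?thesis using True by (simp add: T1_def)
      qed simp
    qed
    also have "\<dots> = (\<integral>\<^sup>+T. indicator {\<nu>. 1 \<le> \<bar>\<nu>\<bar>} T * h T \<partial>lborel) + (\<integral>\<^sup>+T. indicator {\<nu>. 1 \<le> \<bar>\<nu>\<bar>} (-T) * h (-T) \<partial>lborel)"
      by (rule nn_integral_add) measurable
    also have "(\<integral>\<^sup>+T. indicator {\<nu>. 1 \<le> \<bar>\<nu>\<bar>} (-T) * h (-T) \<partial>lborel) = (\<integral>\<^sup>+T. indicator {\<nu>. 1 \<le> \<bar>\<nu>\<bar>} T * h T \<partial>lborel)"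
      using nn_integral_real_affine[of "\<lambda>T. indicator {\<nu>. 1 \<le> \<bar>\<nu>\<bar>} T * h T" "-1" 0] by simp
    also have "(\<integral>\<^sup>+T. indicator {\<nu>. 1 \<le> \<bar>\<nu>\<bar>} T * h T \<partial>lborel) + (\<integral>\<^sup>+T. indicator {\<nu>. 1 \<le> \<bar>\<nu>\<bar>} T * h T \<partial>lborel) < \<infinity>"
      using hfin by simp
    finally have "ennreal e * emeasure lborel {T1..} < \<infinity>"
      by (simp add: nn_integral_cmult)
    then have fin: "emeasure lborel {T1..} < \<infinity>"
      using e by (auto simp: ennreal_mult_less_top)
    define x where "x = enn2real (emeasure lborel {T1..})"
    have "ennreal (x + 1) = emeasure lborel {T1..T1 + (x + 1)}" by (simp add: x_def)
    also have "\<dots> \<le> emeasure lborel {T1..}" by (rule emeasure_mono) auto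
    also have "\<dots> = ennreal x" using fin by (simp add: x_def)
    finally show False by (simp add: x_def)
  qed
  then show ?thesis by simp
qed

section \<open>Consequences of the Hardy space and Hausdorff hypotheses\<close>

lemma nn_integral_inverse_1_plus_square:
  "(\<integral>\<^sup>+x. ennreal (1 / (1 + x\<^sup>2)) \<partial>lborel) < \<infinity>"
proof -
  have "set_integrable lborel (einterval (-\<infinity>) \<infinity>) (\<lambda>x. 1 / (1 + x\<^sup>2))"
    by (rule interval_integral_FTC_nonneg(1)[where F=arctan and A="-(pi/2)" and B="pi/2"])
       (auto intro!: derivative_eq_intros continuous_intros
          simp: ereal_tendsto_simps tendsto_arctan_at_bot tendsto_arctan_at_top add_nonneg_eq_0_iff field_simps)
  then have "integrable lborel (\<lambda>x::real. 1 / (1 + x\<^sup>2))"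
    by (simp add: set_integrable_def)
  then show ?thesis
    by (simp add: integrable_iff_bounded)
qed

text \<open>
  The Hardy norm bounds the open half-plane; the closed boundary line is reached by Fatou's lemma,
  because the function is continuous up to that line.
\<close>

lemma hardy_square_bound:
  assumes "carlsonian_interpolation p a A"
  obtains C where "C \<ge> 0" "\<And>\<sigma>. \<sigma> \<ge> -1/2 \<Longrightarrow>
    (\<integral>\<^sup>+\<nu>. ennreal ((cmod (Complex \<sigma> \<nu> ^ p * A (Complex \<sigma> \<nu>)))\<^sup>2) \<partial>lborel) \<le> ennreal C"
proof -
  define g where "g = (\<lambda>z. z ^ p * A z)"
  define s where "s = (SUP \<sigma>\<in>{-1/2<..}. \<integral>\<^sup>+\<nu>. ennreal ((cmod (g (Complex \<sigma> \<nu>)))\<^sup>2) \<partial>lborel)"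
  have s: "s < \<infinity>" using assms
    by (simp add: carlsonian_interpolation_def hardy2_halfplane_def s_def g_def)
  have contg: "continuous_on {z. Re z \<ge> -1/2} g"
    using assms unfolding carlsonian_interpolation_def g_def by (auto intro!: continuous_intros)
  have inner: "(\<integral>\<^sup>+\<nu>. ennreal ((cmod (g (Complex \<sigma> \<nu>)))\<^sup>2) \<partial>lborel) \<le> s" if "\<sigma> > -1/2" for \<sigma>
    unfolding s_def by (rule SUP_upper) (use that in simp)
  have lineC: "continuous_on UNIV (\<lambda>\<nu>. g (Complex \<sigma> \<nu>))" if "\<sigma> \<ge> -1/2" for \<sigma>
    unfolding Complex_eq
    by (rule continuous_on_compose2[OF contg]) (use that in \<open>auto intro!: continuous_intros\<close>)
  have bdry: "(\<integral>\<^sup>+\<nu>. ennreal ((cmod (g (Complex (-1/2) \<nu>)))\<^sup>2) \<partial>lborel) \<le> s"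
  proof -
    define u where "u k \<nu> = ennreal ((cmod (g (Complex (-1/2 + inverse (real (Suc k))) \<nu>)))\<^sup>2)" for k \<nu>
    have lim: "(\<lambda>k. u k \<nu>) \<longlonglongrightarrow> ennreal ((cmod (g (Complex (-1/2) \<nu>)))\<^sup>2)" for \<nu>
    proof -
      have 0: "(\<lambda>k. -1/2 + inverse (real (Suc k))) \<longlonglongrightarrow> -1/2 + 0"
        by (intro tendsto_intros LIMSEQ_inverse_real_of_nat)
      have 1: "(\<lambda>k. Complex (-1/2 + inverse (real (Suc k))) \<nu>) \<longlonglongrightarrow> Complex (-1/2) \<nu>"
        using tendsto_Complex[OF 0 tendsto_const[of \<nu>]] by simp
      have "(\<lambda>k. g (Complex (-1/2 + inverse (real (Suc k))) \<nu>)) \<longlonglongrightarrow> g (Complex (-1/2) \<nu>)"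
        by (rule continuous_on_tendsto_compose[OF contg 1]) auto
      then show ?thesis unfolding u_def by (intro tendsto_intros)
    qed
    have meas: "u k \<in> borel_measurable lborel" for k
    proof -
      have "(\<lambda>\<nu>. g (Complex (-1/2 + inverse (real (Suc k))) \<nu>)) \<in> borel_measurable borel"
        by (intro borel_measurable_continuous_onI lineC) simp
      then show ?thesis unfolding u_def[abs_def] by measurable
    qed
    have "(\<integral>\<^sup>+\<nu>. ennreal ((cmod (g (Complex (-1/2) \<nu>)))\<^sup>2) \<partial>lborel)
      = (\<integral>\<^sup>+\<nu>. liminf (\<lambda>k. u k \<nu>) \<partial>lborel)"
      by (intro nn_integral_cong lim_imp_Liminf[symmetric] lim) auto
    also have "\<dots> \<le> liminf (\<lambda>k. integral\<^sup>N lborel (u k))"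
      by (rule nn_integral_liminf) (rule meas)
    also have "\<dots> \<le> s"
    proof (rule Liminf_le)
      show "\<forall>\<^sub>F k in sequentially. integral\<^sup>N lborel (u k) \<le> s"
        unfolding u_def[abs_def] by (intro always_eventually allI inner) simp
    qed simp
    finally show ?thesis .
  qed
  show ?thesis
  proof (rule that[of "enn2real s"])
    fix \<sigma> :: real assume "\<sigma> \<ge> -1/2"
    then show "(\<integral>\<^sup>+\<nu>. ennreal ((cmod (Complex \<sigma> \<nu> ^ p * A (Complex \<sigma> \<nu>)))\<^sup>2) \<partial>lborel) \<le> ennreal (enn2real s)"
      using inner[of \<sigma>] bdry s by (cases "\<sigma> = -1/2") (auto simp: g_def)
  qed simp
qed

text \<open>
  Here the exponent p \<ge> 2 enters: for |\<lambda>| \<ge> 1 one has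
  |(2\<lambda> + 1) A(\<lambda>)| \<le> 3 |\<lambda>^p A(\<lambda>)| / |\<lambda>|, which the arithmetic-geometric mean inequality splits
  into the square integrable |\<lambda>^p A(\<lambda>)|^2 and a multiple of 1 / |\<lambda>|^2. On the compact part |\<lambda>| \<le> 1 of the half-plane,
  where \<lambda>^p may be small, continuity of A is used instead.
\<close>

lemma hardy_line_bound:
  assumes A: "carlsonian_interpolation p a A" and p: "p \<ge> 2"
  obtains B where "B \<ge> 0" "\<And>\<sigma>. \<sigma> \<ge> -1/2 \<Longrightarrow>
    (\<integral>\<^sup>+\<nu>. ennreal (cmod ((2 * Complex \<sigma> \<nu> + 1) * A (Complex \<sigma> \<nu>))) \<partial>lborel) \<le> ennreal B"
proof -
  obtain C where C: "C \<ge> 0" "\<And>\<sigma>. \<sigma> \<ge> -1/2 \<Longrightarrow>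
    (\<integral>\<^sup>+\<nu>. ennreal ((cmod (Complex \<sigma> \<nu> ^ p * A (Complex \<sigma> \<nu>)))\<^sup>2) \<partial>lborel) \<le> ennreal C"
    using hardy_square_bound[OF A] by blast
  define b where "b z = (2 * z + 1) * A z" for z
  have contA: "continuous_on {z. Re z \<ge> -1/2} A"
    using A by (simp add: carlsonian_interpolation_def)
  have "compact (cball 0 1 \<inter> {z. Re z \<ge> -1/2})"
    by (intro compact_Int_closed closed_halfspace_Re_ge) auto
  then have "bounded (b ` (cball 0 1 \<inter> {z. Re z \<ge> -1/2}))"
    unfolding b_def
    by (intro compact_imp_bounded compact_continuous_image continuous_intros continuous_on_subset[OF contA]) auto
  then obtain B0 where B0: "B0 > 0" "\<And>z. cmod z \<le> 1 \<Longrightarrow> Re z \<ge> -1/2 \<Longrightarrow> cmod (b z) \<le> B0"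
    unfolding bounded_pos by auto
  define K where "K = 2 * B0 + 18"
  have pt: "cmod (b z) \<le> (cmod (z ^ p * A z))\<^sup>2 + K * (1 / (1 + (Im z)\<^sup>2))" if z: "Re z \<ge> -1/2" for z
  proof (cases "cmod z \<le> 1")
    case True
    have "(Im z)\<^sup>2 \<le> 1" using abs_Im_le_cmod[of z] True by (simp add: abs_square_le_1)
    then have "B0 * (1 + (Im z)\<^sup>2) \<le> B0 * 2" using B0 by (intro mult_left_mono) auto
    also have "\<dots> \<le> K" by (simp add: K_def)
    finally have "B0 \<le> K * (1 / (1 + (Im z)\<^sup>2))"
      by (simp add: field_simps add_pos_nonneg)
    then show ?thesis using B0(2)[OF True z] by (smt (verit) zero_le_power2)
  next
    case False
    define m where "m = cmod z"
    define q where "q = cmod (A z) * m ^ p"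
    have m: "m > 1" using False by (simp add: m_def)
    have "cmod (b z) \<le> (2 * m + 1) * cmod (A z)"
      unfolding b_def m_def norm_mult
      using norm_triangle_ineq[of "2 * z" 1] by (intro mult_right_mono) (auto simp: norm_mult)
    also have "\<dots> \<le> (3 * m) * cmod (A z)" using m by (intro mult_right_mono) auto
    finally have "cmod (b z) * m \<le> 3 * (cmod (A z) * m ^ 2)"
      using m by (simp add: power2_eq_square mult_right_mono mult.assoc mult.left_commute)
         (metis less_eq_real_def mult.assoc mult.commute mult_right_mono zero_less_one order_less_trans)
    also have "\<dots> \<le> 3 * q" unfolding q_def
      using m p by (intro mult_left_mono power_increasing) auto
    finally have "cmod (b z) \<le> 2 * q * (3 / (2 * m))" using m by (simp add: field_simps)
    also have "\<dots> \<le> q\<^sup>2 + (3 / (2 * m))\<^sup>2" by (smt (verit) sum_squares_bound)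
    also have "(3 / (2 * m))\<^sup>2 \<le> K * (1 / (1 + (Im z)\<^sup>2))"
    proof -
      have "(Im z)\<^sup>2 \<le> m\<^sup>2" unfolding m_def by (simp add: abs_Im_le_cmod abs_le_square_iff[symmetric])
      moreover have "1 < m\<^sup>2" using m by (simp add: one_less_power)
      ultimately have "9 * (1 + (Im z)\<^sup>2) \<le> 18 * m\<^sup>2" by simp
      also have "\<dots> \<le> (4 * K) * m\<^sup>2" using B0 by (intro mult_right_mono) (auto simp: K_def)
      finally show ?thesis using m by (simp add: power_divide power_mult_distrib field_simps add_pos_nonneg)
    qed
    finally show ?thesis by (simp add: q_def m_def norm_mult norm_power mult.commute)
  qed
  define I where "I = (\<integral>\<^sup>+x. ennreal (1 / (1 + x\<^sup>2)) \<partial>lborel)"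
  show ?thesis
  proof (rule that[of "C + K * enn2real I"])
    show "0 \<le> C + K * enn2real I" using C B0 by (simp add: K_def)
  next
    fix \<sigma> :: real assume s: "\<sigma> \<ge> -1/2"
    have "(\<lambda>\<nu>. A (Complex \<sigma> \<nu>)) \<in> borel_measurable borel"
      unfolding Complex_eq
      by (rule borel_measurable_continuous_onI, rule continuous_on_compose2[OF contA])
         (use s in \<open>auto intro!: continuous_intros\<close>)
    moreover have "(\<lambda>\<nu>. Complex \<sigma> \<nu>) \<in> borel_measurable borel"
      unfolding Complex_eq by (intro borel_measurable_continuous_onI continuous_intros)
    ultimately have [measurable]: "(\<lambda>\<nu>. (cmod (Complex \<sigma> \<nu> ^ p * A (Complex \<sigma> \<nu>)))\<^sup>2) \<in> borel_measurable borel"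
      by measurable
    have "(\<integral>\<^sup>+\<nu>. ennreal (cmod (b (Complex \<sigma> \<nu>))) \<partial>lborel)
      \<le> (\<integral>\<^sup>+\<nu>. ennreal ((cmod (Complex \<sigma> \<nu> ^ p * A (Complex \<sigma> \<nu>)))\<^sup>2) + ennreal K * ennreal (1 / (1 + \<nu>\<^sup>2)) \<partial>lborel)"
    proof (rule nn_integral_mono)
      fix \<nu>
      have K: "K \<ge> 0" using B0 by (simp add: K_def)
      show "ennreal (cmod (b (Complex \<sigma> \<nu>))) \<le> ennreal ((cmod (Complex \<sigma> \<nu> ^ p * A (Complex \<sigma> \<nu>)))\<^sup>2) + ennreal K * ennreal (1 / (1 + \<nu>\<^sup>2))"
        using pt[of "Complex \<sigma> \<nu>"] s K
        by (simp add: ennreal_plus[symmetric] ennreal_mult[symmetric] del: ennreal_plus)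
    qed
    also have "\<dots> = (\<integral>\<^sup>+\<nu>. ennreal ((cmod (Complex \<sigma> \<nu> ^ p * A (Complex \<sigma> \<nu>)))\<^sup>2) \<partial>lborel) + ennreal K * I"
      unfolding I_def by (simp add: nn_integral_add nn_integral_cmult)
    also have "\<dots> \<le> ennreal C + ennreal K * ennreal (enn2real I)"
      using nn_integral_inverse_1_plus_square unfolding I_def
      by (intro add_mono C s mult_left_mono) auto
    also have "\<dots> = ennreal (C + K * enn2real I)"
      using C B0 by (simp add: ennreal_mult K_def)
    finally show "(\<integral>\<^sup>+\<nu>. ennreal (cmod ((2 * Complex \<sigma> \<nu> + 1) * A (Complex \<sigma> \<nu>))) \<partial>lborel) \<le> ennreal (C + K * enn2real I)"
      by (simp add: b_def)
  qed
qed

text \<open>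
  The term i = 0 of the Hausdorff sums bounds |f n| by a multiple of
  (n+1)^(-(1+\<epsilon>)/(2+\<epsilon>)), an exponent below -1/2. Dividing by n^p with p \<ge> 2 and
  multiplying by 2n+1 leaves O(n^(-3/2)).
\<close>

lemma hausdorff_summable:
  assumes h: "hausdorff_condition f" and f: "\<And>n. f n = real n ^ p * a n" and p: "p \<ge> 2"
  shows "summable (\<lambda>n. \<bar>real (2 * n + 1) * a n\<bar>)"
proof -
  obtain M \<epsilon> where M: "M > 0" "\<epsilon> > 0" and H: "\<And>n. real (n + 1) powr (1 + \<epsilon>) *
          (\<Sum>i=0..n. real (n choose i) powr (2 + \<epsilon>) * \<bar>fdiff_iter i f (n - i)\<bar> powr (2 + \<epsilon>)) < M"
    using h unfolding hausdorff_condition_def by blast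
  have fb: "\<bar>f n\<bar> \<le> M powr (1 / (2 + \<epsilon>)) * real (n + 1) powr (-1/2)" for n
  proof -
    have "\<bar>f n\<bar> powr (2 + \<epsilon>) = (\<Sum>i\<in>{0}. real (n choose i) powr (2 + \<epsilon>) * \<bar>fdiff_iter i f (n - i)\<bar> powr (2 + \<epsilon>))"
      by simp
    also have "\<dots> \<le> (\<Sum>i=0..n. real (n choose i) powr (2 + \<epsilon>) * \<bar>fdiff_iter i f (n - i)\<bar> powr (2 + \<epsilon>))"
      by (rule sum_mono2) auto
    finally have "real (n + 1) powr (1 + \<epsilon>) * \<bar>f n\<bar> powr (2 + \<epsilon>) \<le> M"
      using H[of n] by (smt (verit) mult_left_mono powr_ge_zero)
    then have "\<bar>f n\<bar> powr (2 + \<epsilon>) \<le> M * real (n + 1) powr (-(1 + \<epsilon>))"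
    proof -
      have "real (n + 1) powr (1 + \<epsilon>) > 0" by simp
      then have "\<bar>f n\<bar> powr (2 + \<epsilon>) \<le> M * inverse (real (n + 1) powr (1 + \<epsilon>))"
        using \<open>_ \<le> M\<close> by (metis divide_inverse le_divide_eq mult.commute)
      then show ?thesis by (simp only: powr_minus)
    qed
    also have "\<dots> \<le> M * real (n + 1) powr (- (1 + \<epsilon>/2))"
      using M by (intro mult_left_mono powr_mono) auto
    finally have "(\<bar>f n\<bar> powr (2 + \<epsilon>)) powr (1 / (2 + \<epsilon>)) \<le> (M * real (n + 1) powr (- (1 + \<epsilon>/2))) powr (1 / (2 + \<epsilon>))"
      using M by (intro powr_mono2) auto
    also have "(\<bar>f n\<bar> powr (2 + \<epsilon>)) powr (1 / (2 + \<epsilon>)) = \<bar>f n\<bar>" using M by (simp add: powr_powr)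
    also have "(M * real (n + 1) powr (- (1 + \<epsilon>/2))) powr (1 / (2 + \<epsilon>))
        = M powr (1 / (2 + \<epsilon>)) * real (n + 1) powr (- (1 + \<epsilon>/2) * (1 / (2 + \<epsilon>)))"
      using M by (subst powr_mult) (auto simp: powr_powr)
    also have "- (1 + \<epsilon>/2) * (1 / (2 + \<epsilon>)) = -1/2" using M by (simp add: field_simps)
    finally show ?thesis .
  qed
  define c where "c = 3 * M powr (1 / (2 + \<epsilon>))"
  show ?thesis
  proof (rule summable_comparison_test_ev)
    show "summable (\<lambda>n. c * real n powr (-3/2))"
      by (intro summable_mult) (simp add: summable_real_powr_iff)
    show "\<forall>\<^sub>F n in sequentially. norm \<bar>real (2 * n + 1) * a n\<bar> \<le> c * real n powr (-3/2)"
      using eventually_ge_at_top[of 1]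
    proof eventually_elim
      case (elim n)
      have "real n ^ 2 * \<bar>a n\<bar> \<le> \<bar>f n\<bar>"
        using elim p by (auto simp: f abs_mult intro!: mult_right_mono power_increasing)
      also have "\<dots> \<le> M powr (1 / (2 + \<epsilon>)) * real n powr (-1/2)"
        using elim fb[of n] by (elim order_trans) (auto intro!: mult_left_mono powr_mono2')
      finally have *: "real n ^ 2 * \<bar>a n\<bar> \<le> M powr (1 / (2 + \<epsilon>)) * real n powr (-1/2)" .
      have "\<bar>real (2 * n + 1) * a n\<bar> \<le> 3 * real n * \<bar>a n\<bar>"
        using elim by (auto simp: abs_mult intro!: mult_right_mono)
      also have "\<dots> = 3 * (real n ^ 2 * \<bar>a n\<bar>) / real n" using elim by (simp add: power2_eq_square)
      also have "\<dots> \<le> 3 * (M powr (1 / (2 + \<epsilon>)) * real n powr (-1/2)) / real n"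
        by (intro divide_right_mono mult_left_mono *) auto
      also have "\<dots> = c * (real n powr (-1/2) * real n powr (-1))"
        using elim by (simp add: c_def powr_minus divide_simps)
      also have "real n powr (-1/2) * real n powr (-1) = real n powr (-3/2)"
        by (subst powr_add[symmetric]) simp
      finally show ?case by simp
    qed
  qed
qed

section \<open>A comparison function with one pole, and lower bounds for the sine\<close>

lemma inverse_square_le:
  fixes x :: real
  assumes "1 \<le> \<bar>x\<bar>"
  shows "1 / x\<^sup>2 \<le> 2 * (1 / (1 + x\<^sup>2))"
proof -
  have "1 \<le> x\<^sup>2" using assms by (metis abs_le_square_iff abs_one one_power2)
  then have "1 / x\<^sup>2 \<le> 1 / ((1 + x\<^sup>2) / 2)" by (intro divide_left_mono mult_pos_pos) auto
  then show ?thesis by simp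
qed

lemma integrable_of_inverse_square_tail:
  fixes f :: "real \<Rightarrow> complex"
  assumes cont: "continuous_on UNIV f" and bd: "\<And>x. 1 \<le> \<bar>x\<bar> \<Longrightarrow> cmod (f x) \<le> 1 / x\<^sup>2"
  shows "integrable lborel f"
proof (rule integrable_of_tail_bound[OF cont])
  have "(\<integral>\<^sup>+x. indicator {x. 1 \<le> \<bar>x\<bar>} x * ennreal (cmod (f x)) \<partial>lborel) \<le> (\<integral>\<^sup>+x. ennreal 2 * ennreal (1 / (1 + x\<^sup>2)) \<partial>lborel)"
  proof (rule nn_integral_mono)
    fix x :: real
    show "indicator {x. 1 \<le> \<bar>x\<bar>} x * ennreal (cmod (f x)) \<le> ennreal 2 * ennreal (1 / (1 + x\<^sup>2))"
    proof (cases "1 \<le> \<bar>x\<bar>")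
      case True
      then show ?thesis using bd[OF True] inverse_square_le[OF True]
        by (simp add: ennreal_mult[symmetric] del: ennreal_numeral)
    qed simp
  qed
  also have "\<dots> < \<infinity>"
    using nn_integral_inverse_1_plus_square by (subst nn_integral_cmult) (auto simp: ennreal_mult_less_top)
  finally show "(\<integral>\<^sup>+x. indicator {x. 1 \<le> \<bar>x\<bar>} x * ennreal (cmod (f x)) \<partial>lborel) < \<infinity>" .
qed

lemma tendsto_arctan_mult_at_top:
  assumes "c > 0"
  shows "((\<lambda>T. arctan (T * c)) \<longlongrightarrow> pi / 2) at_top"
  by (rule filterlim_compose[OF tendsto_arctan_at_top])
     (rule filterlim_at_top_mult_tendsto_pos[OF tendsto_const assms filterlim_ident])

text \<open>
  The difference 1/z - 1/(z+1). It has residue 1 at the origin, decays quadratically, and its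
  integrals over vertical lines are elementary, so it can be subtracted from a function with a
  simple pole to make the strip theorem applicable.
\<close>

definition pole_pair :: "complex \<Rightarrow> complex" where
  "pole_pair z = 1 / (z * (z + 1))"

lemma pole_pair_bound:
  assumes "1 \<le> \<bar>Im z\<bar>"
  shows "cmod (pole_pair z) \<le> 1 / (Im z)\<^sup>2"
proof -
  have "\<bar>Im z\<bar> * \<bar>Im z\<bar> \<le> cmod z * cmod (z + 1)"
    using abs_Im_le_cmod[of z] abs_Im_le_cmod[of "z + 1"] by (intro mult_mono) auto
  moreover have "\<bar>Im z\<bar> * \<bar>Im z\<bar> = (Im z)\<^sup>2" by (simp add: power2_eq_square)
  moreover have "0 < (Im z)\<^sup>2" using assms by auto
  ultimately show ?thesis
    by (simp add: pole_pair_def norm_divide norm_mult frac_le)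
qed

text \<open>
  An antiderivative along the line consists of the arctangents below and of a logarithmic part which
  is even and cancels between T and -T.
\<close>

lemma pole_pair_line:
  assumes "\<alpha> \<noteq> 0" "\<alpha> \<noteq> -1"
  shows "integrable lborel (\<lambda>\<nu>. pole_pair (Complex \<alpha> \<nu>))"
    and "((\<lambda>T. 2 * arctan (T / \<alpha>) - 2 * arctan (T / (\<alpha> + 1))) \<longlongrightarrow>
       (LINT \<nu>|lborel. pole_pair (Complex \<alpha> \<nu>))) at_top"
proof -
  have cont: "continuous_on UNIV (\<lambda>\<nu>. pole_pair (Complex \<alpha> \<nu>))"
  proof -
    have "Complex \<alpha> \<nu> \<noteq> 0" "Complex \<alpha> \<nu> + 1 \<noteq> 0" for \<nu>
      using assms by (auto simp: complex_eq_iff)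
    then show ?thesis unfolding pole_pair_def Complex_eq by (intro continuous_intros) auto
  qed
  show int: "integrable lborel (\<lambda>\<nu>. pole_pair (Complex \<alpha> \<nu>))"
    by (rule integrable_of_inverse_square_tail[OF cont]) (use pole_pair_bound[of "Complex \<alpha> _"] in simp)
  define F where "F \<nu> = complex_of_real (arctan (\<nu> / \<alpha>) - arctan (\<nu> / (\<alpha> + 1)))
     - \<i> / 2 * complex_of_real (ln (\<alpha>\<^sup>2 + \<nu>\<^sup>2) - ln ((\<alpha> + 1)\<^sup>2 + \<nu>\<^sup>2))" for \<nu>
  have pos: "\<alpha>\<^sup>2 + \<nu>\<^sup>2 > 0" "(\<alpha> + 1)\<^sup>2 + \<nu>\<^sup>2 > 0" for \<nu>
    using assms by (auto intro!: add_pos_nonneg simp: add_eq_0_iff)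
  have dF: "(F has_vector_derivative pole_pair (Complex \<alpha> \<nu>)) (at \<nu> within X)" for \<nu> X
  proof -
    have at: "((\<lambda>\<nu>. arctan (\<nu> / \<beta>)) has_real_derivative \<beta> / (\<beta>\<^sup>2 + \<nu>\<^sup>2)) (at \<nu> within X)" if "\<beta> \<noteq> 0" for \<beta>
      using that by (auto intro!: derivative_eq_intros simp: field_simps power2_eq_square)
    have ln: "((\<lambda>\<nu>. ln (\<beta>\<^sup>2 + \<nu>\<^sup>2)) has_real_derivative 2 * \<nu> / (\<beta>\<^sup>2 + \<nu>\<^sup>2)) (at \<nu> within X)" if "\<beta> \<noteq> 0" for \<beta>
    proof -
      have "0 < \<beta>\<^sup>2 + \<nu>\<^sup>2" using that by (simp add: add_pos_nonneg)
      then show ?thesis by (auto intro!: derivative_eq_intros)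
    qed
    have nz: "\<alpha> + 1 \<noteq> 0" using assms by auto
    have "(F has_vector_derivative (complex_of_real (\<alpha> / (\<alpha>\<^sup>2 + \<nu>\<^sup>2) - (\<alpha> + 1) / ((\<alpha> + 1)\<^sup>2 + \<nu>\<^sup>2))
         - \<i> / 2 * complex_of_real (2 * \<nu> / (\<alpha>\<^sup>2 + \<nu>\<^sup>2) - 2 * \<nu> / ((\<alpha> + 1)\<^sup>2 + \<nu>\<^sup>2)))) (at \<nu> within X)"
      unfolding F_def[abs_def]
      by (intro has_vector_derivative_diff has_vector_derivative_mult_right has_vector_derivative_of_real DERIV_diff at ln assms(1) nz)
    moreover have "complex_of_real (\<alpha> / (\<alpha>\<^sup>2 + \<nu>\<^sup>2) - (\<alpha> + 1) / ((\<alpha> + 1)\<^sup>2 + \<nu>\<^sup>2))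
         - \<i> / 2 * complex_of_real (2 * \<nu> / (\<alpha>\<^sup>2 + \<nu>\<^sup>2) - 2 * \<nu> / ((\<alpha> + 1)\<^sup>2 + \<nu>\<^sup>2)) = pole_pair (Complex \<alpha> \<nu>)"
    proof -
      have half: "(2 * x - 2 * y) / 2 = x - y" for x y :: real by simp
      have inv: "1 / Complex \<beta> \<nu> = complex_of_real (\<beta> / (\<beta>\<^sup>2 + \<nu>\<^sup>2)) - \<i> * complex_of_real (\<nu> / (\<beta>\<^sup>2 + \<nu>\<^sup>2))" for \<beta>
        by (simp add: complex_eq_iff Re_divide Im_divide power2_eq_square[of "\<beta>\<^sup>2 + \<nu>\<^sup>2"])
      have "pole_pair (Complex \<alpha> \<nu>) = 1 / Complex \<alpha> \<nu> - 1 / Complex (\<alpha> + 1) \<nu>"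
      proof -
        have 1: "Complex (\<alpha> + 1) \<nu> = Complex \<alpha> \<nu> + 1" by (simp add: complex_eq_iff)
        have 2: "Complex \<alpha> \<nu> \<noteq> 0" "Complex \<alpha> \<nu> + 1 \<noteq> 0" using assms by (auto simp: complex_eq_iff)
        show ?thesis unfolding 1 pole_pair_def using 2 by (simp add: divide_simps)
      qed
      then show ?thesis unfolding inv by (simp add: complex_eq_iff half flip: times_divide_eq_right)
    qed
    ultimately show ?thesis by (simp only:)
  qed
  have "(LINT \<nu>|lborel. indicator {-T..T} \<nu> *\<^sub>R pole_pair (Complex \<alpha> \<nu>)) = complex_of_real (2 * arctan (T / \<alpha>) - 2 * arctan (T / (\<alpha> + 1)))"
    if "T \<ge> 0" for T
  proof -
    have "(LINT \<nu>|lborel. indicator {-T..T} \<nu> *\<^sub>R pole_pair (Complex \<alpha> \<nu>)) = F T - F (-T)"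
      by (rule integral_FTC_Icc) (use that dF continuous_on_subset[OF cont] in auto)
    then show ?thesis by (simp add: F_def arctan_minus)
  qed
  then show "((\<lambda>T. 2 * arctan (T / \<alpha>) - 2 * arctan (T / (\<alpha> + 1))) \<longlongrightarrow>
       (LINT \<nu>|lborel. pole_pair (Complex \<alpha> \<nu>))) at_top"
    using tendsto_symmetric_integral[OF int]
    by (elim Lim_transform_eventually) (auto simp: eventually_at_top_linorder intro!: exI[of _ 0])
qed

lemma pole_pair_integral_left: "(LINT \<nu>|lborel. pole_pair (Complex (-1/4) \<nu>)) = -2 * of_real pi"
proof -
  have "((\<lambda>T. complex_of_real (2 * arctan (T / (-1/4)) - 2 * arctan (T / (-1/4 + 1)))) \<longlongrightarrow>
     of_real (2 * - (pi / 2) - 2 * (pi / 2))) at_top"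
    using tendsto_arctan_mult_at_top[of "4/3"] tendsto_minus[OF tendsto_arctan_mult_at_top[of 4]]
    by (intro tendsto_intros) (simp_all add: arctan_minus)
  with pole_pair_line(2)[of "-1/4"] show ?thesis
    using tendsto_unique[OF trivial_limit_at_top_linorder] by fastforce
qed

lemma pole_pair_integral_right: "(LINT \<nu>|lborel. pole_pair (Complex (3/4) \<nu>)) = 0"
proof -
  have "((\<lambda>T. complex_of_real (2 * arctan (T / (3/4)) - 2 * arctan (T / (3/4 + 1)))) \<longlongrightarrow>
     of_real (2 * (pi / 2) - 2 * (pi / 2))) at_top"
    using tendsto_arctan_mult_at_top[of "4/3"] tendsto_arctan_mult_at_top[of "4/7"]
    by (intro tendsto_intros) simp_all
  with pole_pair_line(2)[of "3/4"] show ?thesis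
    using tendsto_unique[OF trivial_limit_at_top_linorder] by fastforce
qed

lemma norm_sin_ge_off_real:
  fixes z :: complex
  assumes "1 \<le> \<bar>Im z\<bar>"
  shows "exp \<bar>Im z\<bar> / 3 \<le> cmod (sin z)"
proof (rule power2_le_imp_le)
  define E where "E = exp (2 * \<bar>Im z\<bar>)"
  have "4 \<le> (2::real)\<^sup>2" by simp
  also have "\<dots> \<le> (exp 1)\<^sup>2" using exp_ge_add_one_self[of "1::real"] by (intro power_mono) auto
  also have "\<dots> = exp (2 * 1)" by (simp add: power2_eq_square flip: exp_add)
  also have "\<dots> \<le> E" using assms by (simp add: E_def)
  finally have E: "E \<ge> 4" .
  have "(exp \<bar>Im z\<bar> / 3)\<^sup>2 = E / 9" by (simp add: E_def power_divide exp_double)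
  also have "\<dots> \<le> (E - 2) / 4" using E by simp
  also have "\<dots> \<le> (exp (2 * Im z) + inverse (exp (2 * Im z)) - 2 * cos (2 * Re z)) / 4"
    unfolding exp_minus[symmetric] E_def
    using cos_le_one[of "2 * Re z"] exp_gt_zero[of "2 * Im z"] exp_gt_zero[of "- (2 * Im z)"]
    by (cases "Im z \<ge> 0") (simp_all del: cos_le_one exp_gt_zero)
  also have "\<dots> = (cmod (sin z))\<^sup>2" by (simp add: norm_sin_squared)
  finally show "(exp \<bar>Im z\<bar> / 3)\<^sup>2 \<le> (cmod (sin z))\<^sup>2" .
qed simp

text \<open>
  On lines halfway between a zero and an extremum of the sine, the term cos (2 Re z) in the formula
  for |sin z|^2 vanishes. These are the lines Re \<lambda> = n - 1/4 after scaling by \<pi>.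
\<close>

lemma norm_sin_ge_mid:
  fixes z :: complex
  assumes "cos (2 * Re z) = 0"
  shows "exp \<bar>Im z\<bar> / 2 \<le> cmod (sin z)"
proof (rule power2_le_imp_le)
  have "(exp \<bar>Im z\<bar> / 2)\<^sup>2 = exp (2 * \<bar>Im z\<bar>) / 4" by (simp add: power_divide exp_double)
  also have "\<dots> \<le> (exp (2 * Im z) + inverse (exp (2 * Im z)) - 2 * cos (2 * Re z)) / 4"
    by (cases "Im z \<ge> 0") (auto simp: assms exp_minus[symmetric])
  also have "\<dots> = (cmod (sin z))\<^sup>2" by (simp add: norm_sin_squared)
  finally show "(exp \<bar>Im z\<bar> / 2)\<^sup>2 \<le> (cmod (sin z))\<^sup>2" .
qed simp

section \<open>The Mellin-Barnes integral and its residues\<close>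

text \<open>
  With w = -e^\<zeta>, this is the kernel (-w)^\<lambda> / sin (\<pi> \<lambda>), whose residue at \<lambda> = n is w^n / \<pi>.
\<close>

definition mb_kernel :: "complex \<Rightarrow> complex \<Rightarrow> complex" where
  "mb_kernel \<zeta> z = exp (z * \<zeta>) / sin (of_real pi * z)"

text \<open>
  The lines Re \<lambda> = n - 1/4 separate consecutive poles of the kernel and, for n = 0, still lie
  in the half-plane Re \<lambda> > -1/2. The sine has the same lower bound on all of them.
\<close>

abbreviation mb_line :: "nat \<Rightarrow> real" where
  "mb_line n \<equiv> real n - 1/4"

lemma norm_exp_mult_le:
  assumes "\<bar>Im \<zeta>\<bar> \<le> pi"
  shows "cmod (exp (z * \<zeta>)) \<le> exp (Re z * Re \<zeta>) * exp (pi * \<bar>Im z\<bar>)"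
proof -
  have "- (Im z * Im \<zeta>) \<le> \<bar>Im z\<bar> * \<bar>Im \<zeta>\<bar>" by (metis abs_ge_minus_self abs_mult)
  also have "\<dots> \<le> \<bar>Im z\<bar> * pi" using assms by (intro mult_left_mono) auto
  finally show ?thesis by (simp add: mult.commute flip: exp_add)
qed

text \<open>
  The growth exp (\<pi> |\<nu>|) of the numerator for |Im \<zeta>| \<le> \<pi> is exactly the growth of the sine, so the kernel
  stays bounded up to and including the two edges of the strip. This is why the extended function
  has boundary values on the cut.
\<close>

lemma mb_kernel_bound_line:
  assumes "\<bar>Im \<zeta>\<bar> \<le> pi"
  shows "cmod (mb_kernel \<zeta> (Complex (mb_line n) \<nu>)) \<le> 2 * exp (mb_line n * Re \<zeta>)"
    and "sin (of_real pi * Complex (mb_line n) \<nu>) \<noteq> 0"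
proof -
  let ?z = "Complex (mb_line n) \<nu>"
  have "cos (2 * Re (of_real pi * ?z)) = cos (2 * pi * real n - pi / 2)"
    by (simp add: algebra_simps)
  also have "\<dots> = 0" using sin_npi[of "2 * n"] by (simp add: cos_diff mult_ac)
  finally have low: "exp (pi * \<bar>\<nu>\<bar>) / 2 \<le> cmod (sin (of_real pi * ?z))"
    using norm_sin_ge_mid[of "of_real pi * ?z"] by (simp add: abs_mult)
  then show "sin (of_real pi * ?z) \<noteq> 0" by (smt (verit) exp_gt_zero half_gt_zero norm_zero)
  have "cmod (mb_kernel \<zeta> ?z) \<le> (exp (mb_line n * Re \<zeta>) * exp (pi * \<bar>\<nu>\<bar>)) / (exp (pi * \<bar>\<nu>\<bar>) / 2)"
    unfolding mb_kernel_def norm_divide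
    using norm_exp_mult_le[OF assms, of ?z] low by (intro frac_le) auto
  then show "cmod (mb_kernel \<zeta> ?z) \<le> 2 * exp (mb_line n * Re \<zeta>)" by simp
qed

lemma mb_kernel_bound_off_real:
  assumes "\<bar>Im \<zeta>\<bar> \<le> pi" "1 \<le> \<bar>Im z\<bar>"
  shows "cmod (mb_kernel \<zeta> z) \<le> 3 * exp (Re z * Re \<zeta>)"
proof -
  have "1 * 1 \<le> pi * \<bar>Im z\<bar>" using assms pi_gt3 by (intro mult_mono) auto
  then have low: "exp (pi * \<bar>Im z\<bar>) / 3 \<le> cmod (sin (of_real pi * z))"
    using norm_sin_ge_off_real[of "of_real pi * z"] by (simp add: abs_mult)
  have "cmod (mb_kernel \<zeta> z) \<le> (exp (Re z * Re \<zeta>) * exp (pi * \<bar>Im z\<bar>)) / (exp (pi * \<bar>Im z\<bar>) / 3)"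
    unfolding mb_kernel_def norm_divide
    using norm_exp_mult_le[OF assms(1), of z] low by (intro frac_le) auto
  then show ?thesis by simp
qed

lemma continuous_on_mb_kernel_line:
  "continuous_on UNIV (\<lambda>\<nu>. mb_kernel \<zeta> (Complex (mb_line n) \<nu>))"
proof -
  have "sin (of_real pi * Complex (mb_line n) \<nu>) \<noteq> 0" for \<nu>
    using mb_kernel_bound_line(2)[of 0 n \<nu>] by simp
  then show ?thesis unfolding mb_kernel_def Complex_eq by (intro continuous_intros) auto
qed

text \<open>
  In the application b(\<lambda>) = (2\<lambda> + 1) A(\<lambda>) / (4\<pi>). All that the contour arguments use is analyticity in the
  half-plane and a bound on the line integrals that is uniform up to the boundary.
\<close>

locale line_integrable =
  fixes b :: "complex \<Rightarrow> complex" and B :: real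
  assumes holo: "b holomorphic_on {z. Re z > -1/2}"
    and cont: "continuous_on {z. Re z \<ge> -1/2} b"
    and B_nonneg: "B \<ge> 0"
    and bound: "\<sigma> \<ge> -1/2 \<Longrightarrow> (\<integral>\<^sup>+\<nu>. ennreal (cmod (b (Complex \<sigma> \<nu>))) \<partial>lborel) \<le> ennreal B"
begin

lemma line_continuous: "\<sigma> \<ge> -1/2 \<Longrightarrow> continuous_on UNIV (\<lambda>\<nu>. b (Complex \<sigma> \<nu>))"
  unfolding Complex_eq
  by (rule continuous_on_compose2[OF cont]) (auto intro!: continuous_intros)

lemma line_integral_le:
  assumes s: "\<sigma> \<ge> -1/2" and k: "continuous_on UNIV k" "\<And>\<nu>. cmod (k \<nu>) \<le> K"
  shows "integrable lborel (\<lambda>\<nu>. b (Complex \<sigma> \<nu>) * k \<nu>)"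
    and "cmod (LINT \<nu>|lborel. b (Complex \<sigma> \<nu>) * k \<nu>) \<le> K * B"
proof -
  have K: "K \<ge> 0" using k(2)[of 0] norm_ge_zero order_trans by blast
  have meas: "(\<lambda>\<nu>. b (Complex \<sigma> \<nu>) * k \<nu>) \<in> borel_measurable borel"
    by (intro borel_measurable_continuous_onI continuous_intros line_continuous s k)
  have meas_b [measurable]: "(\<lambda>\<nu>. b (Complex \<sigma> \<nu>)) \<in> borel_measurable borel"
    by (intro borel_measurable_continuous_onI line_continuous s)
  have "(\<integral>\<^sup>+\<nu>. ennreal (norm (b (Complex \<sigma> \<nu>) * k \<nu>)) \<partial>lborel)
     \<le> (\<integral>\<^sup>+\<nu>. ennreal K * ennreal (cmod (b (Complex \<sigma> \<nu>))) \<partial>lborel)"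
  proof (rule nn_integral_mono)
    fix \<nu>
    have "norm (b (Complex \<sigma> \<nu>) * k \<nu>) \<le> K * cmod (b (Complex \<sigma> \<nu>))"
      using k(2)[of \<nu>] by (simp add: norm_mult mult.commute mult_right_mono)
    then show "ennreal (norm (b (Complex \<sigma> \<nu>) * k \<nu>)) \<le> ennreal K * ennreal (cmod (b (Complex \<sigma> \<nu>)))"
      using K by (simp add: ennreal_mult[symmetric])
  qed
  also have "\<dots> = ennreal K * (\<integral>\<^sup>+\<nu>. ennreal (cmod (b (Complex \<sigma> \<nu>))) \<partial>lborel)"
    by (rule nn_integral_cmult) measurable
  also have "\<dots> \<le> ennreal K * ennreal B" by (intro mult_left_mono bound s) auto
  also have "\<dots> = ennreal (K * B)" using K by (simp add: ennreal_mult B_nonneg)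
  finally have le: "(\<integral>\<^sup>+\<nu>. ennreal (norm (b (Complex \<sigma> \<nu>) * k \<nu>)) \<partial>lborel) \<le> ennreal (K * B)" .
  show int: "integrable lborel (\<lambda>\<nu>. b (Complex \<sigma> \<nu>) * k \<nu>)"
    using meas le by (auto simp: integrable_iff_bounded intro: le_less_trans)
  have "ennreal (cmod (LINT \<nu>|lborel. b (Complex \<sigma> \<nu>) * k \<nu>)) \<le> ennreal (K * B)"
    using integral_norm_bound_ennreal[OF int] le by (rule order_trans)
  then show "cmod (LINT \<nu>|lborel. b (Complex \<sigma> \<nu>) * k \<nu>) \<le> K * B"
    using K B_nonneg by simp
qed

lemma norm_line_integrable: "\<sigma> \<ge> -1/2 \<Longrightarrow> integrable lborel (\<lambda>\<nu>. cmod (b (Complex \<sigma> \<nu>)))"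
  using line_integral_le(1)[of \<sigma> "\<lambda>_. 1" 1] by auto

lemma exp_line_integral_shift:
  fixes \<rho> :: real
  assumes "\<sigma>1 \<ge> -1/2" "\<sigma>1 < \<sigma>2"
  shows "(LINT \<nu>|lborel. b (Complex \<sigma>1 \<nu>) * exp (Complex \<sigma>1 \<nu> * of_real \<rho>))
       = (LINT \<nu>|lborel. b (Complex \<sigma>2 \<nu>) * exp (Complex \<sigma>2 \<nu> * of_real \<rho>))"
proof -
  define K where "K = max (exp (\<sigma>1 * \<rho>)) (exp (\<sigma>2 * \<rho>))"
  show ?thesis
  proof (rule line_integral_shift[where \<Phi> = "\<lambda>z. b z * exp (z * of_real \<rho>)" and B = "K * B"])
    show "continuous_on {z. \<sigma>1 \<le> Re z \<and> Re z \<le> \<sigma>2} (\<lambda>z. b z * exp (z * of_real \<rho>))"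
      using assms by (intro continuous_intros continuous_on_subset[OF cont]) auto
    show "(\<lambda>z. b z * exp (z * of_real \<rho>)) holomorphic_on {z. \<sigma>1 < Re z \<and> Re z < \<sigma>2}"
      using assms by (intro holomorphic_intros holomorphic_on_subset[OF holo]) auto
    fix \<sigma> assume s: "\<sigma>1 \<le> \<sigma>" "\<sigma> \<le> \<sigma>2"
    have K: "exp (\<sigma> * \<rho>) \<le> K"
    proof (cases "\<rho> \<ge> 0")
      case True
      then show ?thesis using s by (simp add: K_def le_max_iff_disj mult_right_mono)
    next
      case False
      then show ?thesis using s by (simp add: K_def le_max_iff_disj mult_right_mono_neg)
    qed
    have K0: "K \<ge> 0" using K exp_gt_zero[of "\<sigma> * \<rho>"] by linarith
    have [measurable]: "(\<lambda>\<nu>. b (Complex \<sigma> \<nu>)) \<in> borel_measurable borel"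
      using s assms by (intro borel_measurable_continuous_onI line_continuous) auto
    have "(\<integral>\<^sup>+\<nu>. indicator {\<nu>. 1 \<le> \<bar>\<nu>\<bar>} \<nu> * ennreal (cmod (b (Complex \<sigma> \<nu>) * exp (Complex \<sigma> \<nu> * of_real \<rho>))) \<partial>lborel)
       \<le> (\<integral>\<^sup>+\<nu>. ennreal K * ennreal (cmod (b (Complex \<sigma> \<nu>))) \<partial>lborel)"
    proof (rule nn_integral_mono)
      fix \<nu>
      show "indicator {\<nu>. 1 \<le> \<bar>\<nu>\<bar>} \<nu> * ennreal (cmod (b (Complex \<sigma> \<nu>) * exp (Complex \<sigma> \<nu> * of_real \<rho>)))
        \<le> ennreal K * ennreal (cmod (b (Complex \<sigma> \<nu>)))"
        using K K0 by (auto simp: indicator_def norm_mult ennreal_mult[symmetric] mult.commute[of K] mult_left_mono)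
    qed
    also have "\<dots> = ennreal K * (\<integral>\<^sup>+\<nu>. ennreal (cmod (b (Complex \<sigma> \<nu>))) \<partial>lborel)"
      by (rule nn_integral_cmult) measurable
    also have "\<dots> \<le> ennreal K * ennreal B" using s assms by (intro mult_left_mono bound) auto
    finally show "(\<integral>\<^sup>+\<nu>. indicator {\<nu>. 1 \<le> \<bar>\<nu>\<bar>} \<nu> * ennreal (cmod (b (Complex \<sigma> \<nu>) * exp (Complex \<sigma> \<nu> * of_real \<rho>))) \<partial>lborel)
       \<le> ennreal (K * B)" using K0 by (simp add: ennreal_mult B_nonneg)
  qed (use assms in auto)
qed

definition mb_integral :: "nat \<Rightarrow> complex \<Rightarrow> complex" where
  "mb_integral n \<zeta> = (LINT \<nu>|lborel. b (Complex (mb_line n) \<nu>) * mb_kernel \<zeta> (Complex (mb_line n) \<nu>))"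

lemma mb_integrable:
  assumes "\<bar>Im \<zeta>\<bar> \<le> pi"
  shows "integrable lborel (\<lambda>\<nu>. b (Complex (mb_line n) \<nu>) * mb_kernel \<zeta> (Complex (mb_line n) \<nu>))"
    and "cmod (mb_integral n \<zeta>) \<le> 2 * exp (mb_line n * Re \<zeta>) * B"
  unfolding mb_integral_def
  by (rule line_integral_le[OF _ continuous_on_mb_kernel_line mb_kernel_bound_line(1)[OF assms]]; simp)+

text \<open>
  Moving the line of integration across the pole at n. The pole is cancelled by a multiple R of the
  comparison function, after which the strip theorem applies; the value -2\<pi> against 0 of the
  comparison integrals on the two lines produces the residue. As the kernel is bounded for
  |Im \<zeta>| \<le> \<pi>, the step holds on the edges of the \<zeta>-strip too.
\<close>

lemma mb_integral_step:
  assumes \<zeta>: "\<bar>Im \<zeta>\<bar> \<le> pi"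
  shows "mb_integral n \<zeta> - mb_integral (Suc n) \<zeta> = - 2 * b (of_nat n) * (- exp \<zeta>) ^ n"
proof -
  define U where "U = {z. real n - 1/2 < Re z}"
  define V where "V = {z. real n - 1/2 < Re z \<and> Re z < real n + 1}"
  have openV: "open V" unfolding V_def
    by (intro open_Collect_conj open_Collect_less continuous_intros)
  have nV: "of_nat n \<in> V" by (simp add: V_def)
  have npi: "of_real pi * of_nat n = complex_of_real (real n * pi)" by simp
  have sin_n: "sin (of_real pi * (of_nat n :: complex)) = 0"
    unfolding npi by (simp only: sin_of_real sin_npi of_real_0)
  \<comment> \<open>The entire function sin (\<pi> z) / (z - n), without zeros in V.\<close>
  define s where "s z = (if z = of_nat n then deriv (\<lambda>z. sin (of_real pi * z)) (of_nat n)
     else (sin (of_real pi * z) - sin (of_real pi * of_nat n)) / (z - of_nat n))" for z :: complex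
  have holo_s: "s holomorphic_on V"
    unfolding s_def
    by (rule pole_lemma) (use openV nV in \<open>auto intro!: holomorphic_intros simp: interior_open\<close>)
  have "((\<lambda>z. sin (of_real pi * z)) has_field_derivative of_real pi * cos (of_real pi * of_nat n)) (at (of_nat n :: complex))"
    by (auto intro!: derivative_eq_intros)
  then have "s (of_nat n) = of_real pi * cos (of_real pi * of_nat n)"
    by (simp add: s_def DERIV_imp_deriv)
  also have "cos (of_real pi * of_nat n :: complex) = (-1) ^ n"
    unfolding npi by (simp only: cos_of_real cos_npi) simp
  finally have s_n: "s (of_nat n) = of_real pi * (-1) ^ n" .
  have s_other: "s z = sin (of_real pi * z) / (z - of_nat n)" if "z \<noteq> of_nat n" for z
    using that by (simp add: s_def sin_n)
  have sin_nz: "sin (of_real pi * z) \<noteq> 0" if z: "z \<in> V" "z \<noteq> of_nat n" for z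
  proof
    assume "sin (of_real pi * z) = 0"
    then obtain k :: int where k: "of_real pi * z = of_real (real_of_int k * pi)"
      by (auto simp: sin_eq_0)
    then have "of_real pi * z = of_real pi * of_int k" by (simp add: mult.commute)
    then have zk: "z = of_int k" by (simp only: mult_cancel_left) simp
    with z have "real n - 1/2 < real_of_int k" "real_of_int k < real n + 1" by (auto simp: V_def)
    then have "k = int n" by linarith
    with z zk show False by simp
  qed
  have s_nz: "s z \<noteq> 0" if "z \<in> V" for z
    using s_n s_other[of z] sin_nz[OF that] by (cases "z = of_nat n") auto
  define H where "H z = b z * exp (z * \<zeta>) / s z" for z
  have V_sub: "V \<subseteq> {z. Re z > -1/2}" by (auto simp: V_def)
  have holo_H: "H holomorphic_on V"
    unfolding H_def using s_nz
    by (intro holomorphic_intros holo_s holomorphic_on_subset[OF holo V_sub]) auto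
  define R where "R = H (of_nat n)"
  \<comment> \<open>N vanishes at n, so that its quotient by z - n has a removable singularity there.\<close>
  define N where "N z = H z - R / (z - of_nat n + 1)" for z
  have nz1: "z - of_nat n + 1 \<noteq> 0" if "z \<in> V" for z
  proof
    assume "z - of_nat n + 1 = 0"
    then have "Re (z - of_nat n + 1) = Re 0" by metis
    then show False using that by (simp add: V_def)
  qed
  have holo_N: "N holomorphic_on V"
    unfolding N_def using nz1 by (intro holomorphic_intros holo_H) auto
  define \<Phi> where "\<Phi> z = (if z = of_nat n then deriv N (of_nat n) else (N z - N (of_nat n)) / (z - of_nat n))" for z
  have holo_\<Phi>: "\<Phi> holomorphic_on V"
    unfolding \<Phi>_def by (rule pole_lemma[OF holo_N]) (use openV nV in \<open>simp add: interior_open\<close>)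
  have N_n: "N (of_nat n) = 0" by (simp add: N_def R_def)
  have \<Phi>_eq: "\<Phi> z = b z * mb_kernel \<zeta> z - R * pole_pair (z - of_nat n)" if "z \<in> V" "z \<noteq> of_nat n" for z
  proof -
    define w where "w = z - of_nat n"
    have w: "w \<noteq> 0" "w + 1 \<noteq> 0" using that nz1[of z] by (auto simp: w_def)
    have "H z = b z * mb_kernel \<zeta> z * w"
      using that by (simp add: H_def s_other mb_kernel_def w_def)
    then have "\<Phi> z = (b z * mb_kernel \<zeta> z * w - R / (w + 1)) / w"
      using that by (simp add: \<Phi>_def N_n) (simp add: N_def w_def)
    also have "\<dots> = b z * mb_kernel \<zeta> z - R * pole_pair w"
      using w by (simp add: pole_pair_def divide_simps)
    finally show ?thesis by (simp add: w_def)
  qed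
  define E where "E = exp ((real n + 1) * \<bar>Re \<zeta>\<bar>)"
  have E0: "E > 0" by (simp add: E_def)
  define L where "L = (\<integral>\<^sup>+x. ennreal (1 / (1 + x\<^sup>2)) \<partial>lborel)"
  have L: "L < \<infinity>" unfolding L_def by (rule nn_integral_inverse_1_plus_square)
  have in_V: "Complex \<sigma> \<nu> \<in> V" if "mb_line n \<le> \<sigma>" "\<sigma> \<le> mb_line (Suc n)" for \<sigma> \<nu>
    using that by (simp add: V_def)
  have "(LINT \<nu>|lborel. \<Phi> (Complex (mb_line n) \<nu>)) = (LINT \<nu>|lborel. \<Phi> (Complex (mb_line (Suc n)) \<nu>))"
  proof (rule line_integral_shift[where B = "3 * E * B + 2 * cmod R * enn2real L"])
    show "mb_line n < mb_line (Suc n)" by simp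
    show "continuous_on {z. mb_line n \<le> Re z \<and> Re z \<le> mb_line (Suc n)} \<Phi>"
      by (rule continuous_on_subset[OF holomorphic_on_imp_continuous_on[OF holo_\<Phi>]]) (auto simp: V_def)
    show "\<Phi> holomorphic_on {z. mb_line n < Re z \<and> Re z < mb_line (Suc n)}"
      by (rule holomorphic_on_subset[OF holo_\<Phi>]) (auto simp: V_def)
    fix \<sigma> assume s: "mb_line n \<le> \<sigma>" "\<sigma> \<le> mb_line (Suc n)"
    have [measurable]: "(\<lambda>\<nu>. b (Complex \<sigma> \<nu>)) \<in> borel_measurable borel"
      using s by (intro borel_measurable_continuous_onI line_continuous) auto
    have "(\<integral>\<^sup>+\<nu>. indicator {\<nu>. 1 \<le> \<bar>\<nu>\<bar>} \<nu> * ennreal (cmod (\<Phi> (Complex \<sigma> \<nu>))) \<partial>lborel)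
       \<le> (\<integral>\<^sup>+\<nu>. ennreal (3 * E) * ennreal (cmod (b (Complex \<sigma> \<nu>))) + ennreal (2 * cmod R) * ennreal (1 / (1 + \<nu>\<^sup>2)) \<partial>lborel)"
    proof (rule nn_integral_mono)
      fix \<nu>
      show "indicator {\<nu>. 1 \<le> \<bar>\<nu>\<bar>} \<nu> * ennreal (cmod (\<Phi> (Complex \<sigma> \<nu>)))
         \<le> ennreal (3 * E) * ennreal (cmod (b (Complex \<sigma> \<nu>))) + ennreal (2 * cmod R) * ennreal (1 / (1 + \<nu>\<^sup>2))"
      proof (cases "1 \<le> \<bar>\<nu>\<bar>")
        case True
        let ?z = "Complex \<sigma> \<nu>"
        have "\<sigma> * Re \<zeta> \<le> (real n + 1) * \<bar>Re \<zeta>\<bar>"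
        proof -
          have "\<sigma> * Re \<zeta> \<le> \<bar>\<sigma>\<bar> * \<bar>Re \<zeta>\<bar>" by (metis abs_ge_self abs_mult)
          also have "\<dots> \<le> (real n + 1) * \<bar>Re \<zeta>\<bar>" using s by (intro mult_right_mono) auto
          finally show ?thesis .
        qed
        then have "cmod (mb_kernel \<zeta> ?z) \<le> 3 * E"
          using mb_kernel_bound_off_real[OF \<zeta>, of ?z] True by (simp add: E_def) (smt (verit) exp_le_cancel_iff)
        then have 1: "cmod (b ?z * mb_kernel \<zeta> ?z) \<le> 3 * E * cmod (b ?z)"
          unfolding norm_mult by (metis mult.commute mult_right_mono norm_ge_zero)
        have "cmod (pole_pair (?z - of_nat n)) \<le> 2 * (1 / (1 + \<nu>\<^sup>2))"
          using pole_pair_bound[of "?z - of_nat n"] inverse_square_le[OF True] True by simp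
        then have 2: "cmod (R * pole_pair (?z - of_nat n)) \<le> 2 * cmod R * (1 / (1 + \<nu>\<^sup>2))"
          unfolding norm_mult by (metis mult.assoc mult.commute mult_left_mono norm_ge_zero)
        have "?z \<noteq> of_nat n" using True by (auto simp: complex_eq_iff)
        then have "\<Phi> ?z = b ?z * mb_kernel \<zeta> ?z - R * pole_pair (?z - of_nat n)"
          by (intro \<Phi>_eq in_V s)
        then have "cmod (\<Phi> ?z) \<le> 3 * E * cmod (b ?z) + 2 * cmod R * (1 / (1 + \<nu>\<^sup>2))"
          using 1 2 by (auto intro: order_trans[OF norm_triangle_ineq4] add_mono simp only:)
        then have "ennreal (cmod (\<Phi> ?z)) \<le> ennreal (3 * E * cmod (b ?z) + 2 * cmod R * (1 / (1 + \<nu>\<^sup>2)))"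
          by (rule ennreal_leI)
        also have "\<dots> = ennreal (3 * E) * ennreal (cmod (b ?z)) + ennreal (2 * cmod R) * ennreal (1 / (1 + \<nu>\<^sup>2))"
        proof -
          have "ennreal (3 * E * cmod (b ?z)) = ennreal (3 * E) * ennreal (cmod (b ?z))"
            by (rule ennreal_mult) (use E0 in auto)
          moreover have "ennreal (2 * cmod R * (1 / (1 + \<nu>\<^sup>2))) = ennreal (2 * cmod R) * ennreal (1 / (1 + \<nu>\<^sup>2))"
            by (rule ennreal_mult) auto
          moreover have "ennreal (3 * E * cmod (b ?z) + 2 * cmod R * (1 / (1 + \<nu>\<^sup>2)))
             = ennreal (3 * E * cmod (b ?z)) + ennreal (2 * cmod R * (1 / (1 + \<nu>\<^sup>2)))"
            by (rule ennreal_plus) (use E0 in auto)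
          ultimately show ?thesis by (simp only:)
        qed
        finally show ?thesis using True by simp
      qed simp
    qed
    also have "\<dots> = ennreal (3 * E) * (\<integral>\<^sup>+\<nu>. ennreal (cmod (b (Complex \<sigma> \<nu>))) \<partial>lborel) + ennreal (2 * cmod R) * L"
      unfolding L_def by (subst nn_integral_add) (auto simp: nn_integral_cmult)
    also have "\<dots> \<le> ennreal (3 * E) * ennreal B + ennreal (2 * cmod R) * ennreal (enn2real L)"
      using L s by (intro add_mono mult_left_mono bound) auto
    also have "\<dots> = ennreal (3 * E * B + 2 * cmod R * enn2real L)"
      using E0 B_nonneg by (simp add: ennreal_mult)
    finally show "(\<integral>\<^sup>+\<nu>. indicator {\<nu>. 1 \<le> \<bar>\<nu>\<bar>} \<nu> * ennreal (cmod (\<Phi> (Complex \<sigma> \<nu>))) \<partial>lborel)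
      \<le> ennreal (3 * E * B + 2 * cmod R * enn2real L)" .
  qed
  moreover have lines: "(LINT \<nu>|lborel. \<Phi> (Complex (mb_line m) \<nu>)) = mb_integral m \<zeta> - R * (LINT \<nu>|lborel. pole_pair (Complex (mb_line m - real n) \<nu>))"
    if m: "m = n \<or> m = Suc n" for m
  proof -
    have eq: "\<Phi> (Complex (mb_line m) \<nu>) = b (Complex (mb_line m) \<nu>) * mb_kernel \<zeta> (Complex (mb_line m) \<nu>) - R * pole_pair (Complex (mb_line m - real n) \<nu>)" for \<nu>
    proof -
      have "Complex (mb_line m) \<nu> - of_nat n = Complex (mb_line m - real n) \<nu>" by (simp add: complex_eq_iff)
      moreover have "Complex (mb_line m) \<nu> \<noteq> of_nat n" using m by (auto simp: complex_eq_iff)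
      ultimately show ?thesis using \<Phi>_eq[of "Complex (mb_line m) \<nu>"] in_V m by fastforce
    qed
    show ?thesis unfolding eq mb_integral_def
      using m by (subst Bochner_Integration.integral_diff)
       (auto intro!: mb_integrable \<zeta> pole_pair_line)
  qed
  ultimately have "mb_integral n \<zeta> - R * (LINT \<nu>|lborel. pole_pair (Complex (-1/4) \<nu>))
     = mb_integral (Suc n) \<zeta> - R * (LINT \<nu>|lborel. pole_pair (Complex (3/4) \<nu>))"
    using lines[of n] lines[of "Suc n"] by simp
  then have "mb_integral n \<zeta> - mb_integral (Suc n) \<zeta> = - 2 * of_real pi * R"
    unfolding pole_pair_integral_left pole_pair_integral_right by (simp add: algebra_simps)
  also have "\<dots> = - 2 * b (of_nat n) * (- exp \<zeta>) ^ n"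
  proof -
    have pm: "(- exp \<zeta>) ^ n = (-1) ^ n * exp \<zeta> ^ n" by (rule power_minus)
    have "R = b (of_nat n) * exp \<zeta> ^ n / (of_real pi * (-1) ^ n)"
      by (simp only: R_def H_def s_n exp_of_nat_mult)
    then show ?thesis unfolding pm by (cases "even n") simp_all
  qed
  finally show ?thesis .
qed

end

section \<open>Analyticity and continuation of the generating function\<close>

context line_integrable begin

lemma line_tail_tendsto_0:
  "((\<lambda>T. LINT \<nu>|lborel. indicator (- {-T..T}) \<nu> * cmod (b (Complex (mb_line 0) \<nu>))) \<longlongrightarrow> 0) at_top"
proof -
  have int: "integrable lborel (\<lambda>\<nu>. cmod (b (Complex (mb_line 0) \<nu>)))"
    by (rule norm_line_integrable) simp
  have "((\<lambda>T. LINT \<nu>|lborel. indicator (- {-T..T}) \<nu> * cmod (b (Complex (mb_line 0) \<nu>))) \<longlongrightarrow> (LINT \<nu>|(lborel::real measure). 0)) at_top"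
  proof (rule integral_dominated_convergence_at_top[where w = "\<lambda>\<nu>. cmod (b (Complex (mb_line 0) \<nu>))"])
    show "(\<lambda>\<nu>. indicator (- {-T..T}) \<nu> * cmod (b (Complex (mb_line 0) \<nu>))) \<in> borel_measurable lborel" for T
      using int by measurable
    show "\<forall>\<^sub>F T in at_top. AE \<nu> in lborel. norm (indicat_real (- {- T..T}) \<nu> * cmod (b (Complex (mb_line 0) \<nu>))) \<le> cmod (b (Complex (mb_line 0) \<nu>))"
      by (intro always_eventually allI AE_I2) (auto simp: indicator_def)
    show "AE \<nu> in lborel. ((\<lambda>T. indicat_real (- {- T..T}) \<nu> * cmod (b (Complex (mb_line 0) \<nu>))) \<longlongrightarrow> 0) at_top"
    proof (rule AE_I2, rule tendsto_eventually)
      show "\<forall>\<^sub>F T in at_top. indicat_real (- {- T..T}) \<nu> * cmod (b (Complex (mb_line 0) \<nu>)) = 0" for \<nu>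
        using eventually_ge_at_top[of "\<bar>\<nu>\<bar>"] by eventually_elim (auto simp: indicator_def)
    qed
  qed (use int in auto)
  then show ?thesis by simp
qed

definition mb_trunc :: "nat \<Rightarrow> complex \<Rightarrow> complex" where
  "mb_trunc k \<zeta> = integral (cbox (- real k) (real k)) (\<lambda>\<nu>. b (Complex (mb_line 0) \<nu>) * mb_kernel \<zeta> (Complex (mb_line 0) \<nu>))"

lemma holomorphic_mb_trunc: "mb_trunc k holomorphic_on UNIV"
  unfolding mb_trunc_def[abs_def]
proof (rule leibniz_rule_holomorphic)
  let ?z = "\<lambda>\<nu>. Complex (mb_line 0) \<nu>"
  have nz: "sin (of_real pi * ?z \<nu>) \<noteq> 0" for \<nu> by (rule mb_kernel_bound_line(2)[of 0]) simp
  show "((\<lambda>\<zeta>. b (?z \<nu>) * mb_kernel \<zeta> (?z \<nu>)) has_field_derivative b (?z \<nu>) * (?z \<nu> * mb_kernel \<zeta> (?z \<nu>))) (at \<zeta> within UNIV)" for \<zeta> \<nu>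
    unfolding mb_kernel_def using nz by (auto intro!: derivative_eq_intros)
  have lc: "continuous_on UNIV (\<lambda>\<nu>. b (?z \<nu>))" by (rule line_continuous) simp
  show "(\<lambda>\<nu>. b (?z \<nu>) * mb_kernel \<zeta> (?z \<nu>)) integrable_on cbox (- real k) (real k)" for \<zeta>
    by (intro integrable_continuous continuous_intros continuous_on_subset[OF lc]
          continuous_on_subset[OF continuous_on_mb_kernel_line]) auto
  have "continuous_on UNIV (\<lambda>p. mb_kernel (fst p) (?z (snd p)))"
    using nz unfolding mb_kernel_def Complex_eq by (intro continuous_intros) auto
  moreover have "continuous_on UNIV (\<lambda>p::complex \<times> real. b (?z (snd p)))"
    by (rule continuous_on_compose2[OF lc]) (auto intro!: continuous_intros)
  moreover have "continuous_on UNIV (\<lambda>p::complex \<times> real. ?z (snd p))"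
    unfolding Complex_eq by (intro continuous_intros)
  ultimately have "continuous_on UNIV (\<lambda>p. b (?z (snd p)) * (?z (snd p) * mb_kernel (fst p) (?z (snd p))))"
    by (intro continuous_intros)
  then show "continuous_on (UNIV \<times> cbox (- real k) (real k)) (\<lambda>(\<zeta>, \<nu>). b (?z \<nu>) * (?z \<nu> * mb_kernel \<zeta> (?z \<nu>)))"
    by (auto simp: case_prod_unfold intro: continuous_on_subset)
qed auto

text \<open>
  The truncated integrals are entire in \<zeta>. They converge uniformly where Re \<zeta> is bounded below, since
  the kernel is bounded there and b is integrable along the line; continuity on the closed strip
  and analyticity inside it pass to the limit.
\<close>

lemma mb_trunc_uniform_limit:
  "uniform_limit {\<zeta>. \<bar>Im \<zeta>\<bar> \<le> pi \<and> - K \<le> Re \<zeta>} mb_trunc (mb_integral 0) sequentially"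
proof (rule uniform_limitI)
  fix e :: real assume e: "0 < e"
  let ?z = "\<lambda>\<nu>. Complex (mb_line 0) \<nu>"
  define C where "C = 2 * exp (K / 4)"
  have C: "C > 0" by (simp add: C_def)
  define tl where "tl T = (LINT \<nu>|lborel. indicator (- {-T..T}) \<nu> * cmod (b (?z \<nu>)))" for T :: real
  have "(\<lambda>k. C * tl (real k)) \<longlonglongrightarrow> C * 0"
    unfolding tl_def
    by (intro tendsto_mult tendsto_const filterlim_compose[OF line_tail_tendsto_0] filterlim_real_sequentially)
  then have "\<forall>\<^sub>F k in sequentially. C * tl (real k) < e"
    using e by (intro order_tendstoD) auto
  then show "\<forall>\<^sub>F k in sequentially. \<forall>\<zeta>\<in>{\<zeta>. \<bar>Im \<zeta>\<bar> \<le> pi \<and> - K \<le> Re \<zeta>}. dist (mb_trunc k \<zeta>) (mb_integral 0 \<zeta>) < e"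
  proof eventually_elim
    case (elim k)
    show ?case
    proof
      fix \<zeta> assume \<zeta>: "\<zeta> \<in> {\<zeta>. \<bar>Im \<zeta>\<bar> \<le> pi \<and> - K \<le> Re \<zeta>}"
      define h where "h \<nu> = b (?z \<nu>) * mb_kernel \<zeta> (?z \<nu>)" for \<nu>
      have ih: "integrable lborel h" unfolding h_def[abs_def] using \<zeta> by (intro mb_integrable) auto
      have "set_integrable lborel (cbox (- real k) (real k)) h"
        unfolding set_integrable_def by (rule integrable_mult_indicator) (use ih in auto)
      then have "mb_trunc k \<zeta> = (LINT \<nu>:cbox (- real k) (real k)|lborel. h \<nu>)"
        unfolding mb_trunc_def h_def by (rule set_borel_integral_eq_integral(2)[symmetric])
      then have tr: "mb_trunc k \<zeta> = (LINT \<nu>|lborel. indicator {- real k..real k} \<nu> *\<^sub>R h \<nu>)"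
        by (simp add: set_lebesgue_integral_def)
      have "mb_integral 0 \<zeta> - mb_trunc k \<zeta> = (LINT \<nu>|lborel. h \<nu> - indicator {- real k..real k} \<nu> *\<^sub>R h \<nu>)"
        unfolding tr mb_integral_def h_def[symmetric]
        by (rule Bochner_Integration.integral_diff[symmetric]) (use ih in \<open>auto intro: integrable_mult_indicator\<close>)
      also have "cmod \<dots> \<le> (LINT \<nu>|lborel. C * (indicator (- {- real k..real k}) \<nu> * cmod (b (?z \<nu>))))"
      proof (rule Bochner_Integration.integral_norm_bound_integral)
        show "integrable lborel (\<lambda>\<nu>. h \<nu> - indicator {- real k..real k} \<nu> *\<^sub>R h \<nu>)"
          using ih by (auto intro!: integrable_mult_indicator)
        have "integrable lborel (\<lambda>\<nu>. indicator (- {- real k..real k}) \<nu> *\<^sub>R cmod (b (?z \<nu>)))"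
          by (intro integrable_mult_indicator norm_line_integrable) auto
        then show "integrable lborel (\<lambda>\<nu>. C * (indicator (- {- real k..real k}) \<nu> * cmod (b (?z \<nu>))))"
          by simp
        fix \<nu>
        have "cmod (mb_kernel \<zeta> (?z \<nu>)) \<le> 2 * exp (mb_line 0 * Re \<zeta>)"
          using \<zeta> by (intro mb_kernel_bound_line) auto
        also have "\<dots> \<le> C" using \<zeta> by (simp add: C_def)
        finally have "cmod (h \<nu>) \<le> C * cmod (b (?z \<nu>))"
          unfolding h_def norm_mult by (metis mult.commute mult_right_mono norm_ge_zero)
        then show "cmod (h \<nu> - indicator {- real k..real k} \<nu> *\<^sub>R h \<nu>) \<le> C * (indicator (- {- real k..real k}) \<nu> * cmod (b (?z \<nu>)))"
          by (auto simp: indicator_def)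
      qed
      also have "\<dots> = C * tl (real k)" by (simp add: tl_def)
      finally show "dist (mb_trunc k \<zeta>) (mb_integral 0 \<zeta>) < e"
        using elim by (simp add: dist_norm norm_minus_commute)
    qed
  qed
qed

text \<open>
  Uniform convergence is available only for Re \<zeta> \<ge> -K, so continuity is proved locally.
\<close>

lemma continuous_mb_integral: "continuous_on {\<zeta>. \<bar>Im \<zeta>\<bar> \<le> pi} (mb_integral 0)"
proof (clarsimp simp: continuous_on_eq_continuous_within)
  fix \<zeta> :: complex assume \<zeta>: "\<bar>Im \<zeta>\<bar> \<le> pi"
  define K where "K = 1 - Re \<zeta>"
  have "continuous_on {\<zeta>. \<bar>Im \<zeta>\<bar> \<le> pi \<and> - K \<le> Re \<zeta>} (mb_integral 0)"
    by (rule uniform_limit_theorem[OF _ mb_trunc_uniform_limit])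
       (auto intro!: always_eventually continuous_on_subset[OF holomorphic_on_imp_continuous_on[OF holomorphic_mb_trunc]])
  then have "continuous (at \<zeta> within {\<zeta>. \<bar>Im \<zeta>\<bar> \<le> pi \<and> - K \<le> Re \<zeta>}) (mb_integral 0)"
    using \<zeta> by (auto simp: continuous_on_eq_continuous_within K_def)
  also have "at \<zeta> within {\<zeta>. \<bar>Im \<zeta>\<bar> \<le> pi \<and> - K \<le> Re \<zeta>} = at \<zeta> within {\<zeta>. \<bar>Im \<zeta>\<bar> \<le> pi}"
    by (rule at_within_nhd[of _ "{z. Re z > - K}"]) (auto simp: K_def open_halfspace_Re_gt)
  finally show "continuous (at \<zeta> within {\<zeta>. \<bar>Im \<zeta>\<bar> \<le> pi}) (mb_integral 0)" .
qed

lemma holomorphic_mb_integral: "mb_integral 0 holomorphic_on {\<zeta>. \<bar>Im \<zeta>\<bar> < pi}"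
proof (rule holomorphic_uniform_sequence)
  show op: "open {\<zeta>. \<bar>Im \<zeta>\<bar> < pi}" by (intro open_Collect_less continuous_intros)
  show "mb_trunc n holomorphic_on {\<zeta>. \<bar>Im \<zeta>\<bar> < pi}" for n
    by (rule holomorphic_on_subset[OF holomorphic_mb_trunc]) auto
  fix x :: complex assume "x \<in> {\<zeta>. \<bar>Im \<zeta>\<bar> < pi}"
  then obtain d where d: "d > 0" "cball x d \<subseteq> {\<zeta>. \<bar>Im \<zeta>\<bar> < pi}"
    using op by (meson open_contains_cball)
  have "uniform_limit (cball x d) mb_trunc (mb_integral 0) sequentially"
  proof (rule uniform_limit_on_subset[OF mb_trunc_uniform_limit[of "d - Re x"]])
    show "cball x d \<subseteq> {\<zeta>. \<bar>Im \<zeta>\<bar> \<le> pi \<and> - (d - Re x) \<le> Re \<zeta>}"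
    proof
      fix y assume y: "y \<in> cball x d"
      then have "\<bar>Re (x - y)\<bar> \<le> d" using abs_Re_le_cmod[of "x - y"] by (simp add: dist_norm)
      with y d(2) show "y \<in> {\<zeta>. \<bar>Im \<zeta>\<bar> \<le> pi \<and> - (d - Re x) \<le> Re \<zeta>}" by force
    qed
  qed
  with d show "\<exists>d>0. cball x d \<subseteq> {\<zeta>. \<bar>Im \<zeta>\<bar> < pi} \<and> uniform_limit (cball x d) mb_trunc (mb_integral 0) sequentially"
    by blast
qed

end

text \<open>
  Summability at the nonnegative integers makes the power series with coefficients b(n) converge up to
  and including the unit circle.
\<close>

locale summable_line_integrable = line_integrable +
  assumes summable_nodes: "summable (\<lambda>n. cmod (b (of_nat n)))"
begin

definition node_series :: "complex \<Rightarrow> complex" where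
  "node_series w = (\<Sum>n. b (of_nat n) * w ^ n)"

lemma series_term_le: "cmod w \<le> 1 \<Longrightarrow> cmod (b (of_nat n) * w ^ n) \<le> cmod (b (of_nat n))"
  by (simp add: norm_mult norm_power mult_left_le power_le_one)

lemma series_sums: "cmod w \<le> 1 \<Longrightarrow> (\<lambda>n. b (of_nat n) * w ^ n) sums node_series w"
  unfolding node_series_def
  by (intro summable_sums summable_comparison_test'[OF summable_nodes]) (use series_term_le in auto)

lemma series_norm_le: "cmod w \<le> 1 \<Longrightarrow> cmod (node_series w) \<le> (\<Sum>n. cmod (b (of_nat n)))"
  unfolding node_series_def by (intro norm_suminf_le series_term_le summable_nodes)

lemma series_uniform_limit:
  "uniform_limit (cball 0 1) (\<lambda>N w. \<Sum>n<N. b (of_nat n) * w ^ n) node_series sequentially"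
  unfolding node_series_def[abs_def]
  by (rule Weierstrass_m_test[OF _ summable_nodes]) (use series_term_le in auto)

lemma continuous_series: "continuous_on (cball 0 1) node_series"
  by (rule uniform_limit_theorem[OF _ series_uniform_limit])
     (auto intro!: always_eventually continuous_intros)

lemma holomorphic_series: "node_series holomorphic_on ball 0 1"
proof (rule holomorphic_uniform_sequence)
  fix x :: complex assume "x \<in> ball 0 1"
  then obtain d where d: "d > 0" "cball x d \<subseteq> ball 0 1"
    by (meson open_ball open_contains_cball)
  then have "uniform_limit (cball x d) (\<lambda>N w. \<Sum>n<N. b (of_nat n) * w ^ n) node_series sequentially"
    by (intro uniform_limit_on_subset[OF series_uniform_limit]) (use ball_subset_cball in blast)
  with d show "\<exists>d>0. cball x d \<subseteq> ball 0 1 \<and> uniform_limit (cball x d) (\<lambda>N w. \<Sum>n<N. b (of_nat n) * w ^ n) node_series sequentially"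
    by blast
qed (auto intro!: holomorphic_intros)

definition mellin_barnes :: "complex \<Rightarrow> complex" where "mellin_barnes \<zeta> = - mb_integral 0 \<zeta> / 2"

text \<open>
  For Re \<zeta> < 0 the line of integration is pushed to infinity; the residues collected on the way are
  the terms of the power series at w = -e^\<zeta>.
\<close>

lemma mb_eq_series_open:
  assumes "\<bar>Im \<zeta>\<bar> \<le> pi" "Re \<zeta> < 0"
  shows "mellin_barnes \<zeta> = node_series (- exp \<zeta>)"
proof -
  have part: "mb_integral 0 \<zeta> - mb_integral N \<zeta> = - 2 * (\<Sum>n<N. b (of_nat n) * (- exp \<zeta>) ^ n)" for N
  proof (induction N)
    case (Suc N)
    then show ?case using mb_integral_step[OF assms(1), of N] by (simp add: algebra_simps)
  qed simp
  have "(\<lambda>N. mb_integral N \<zeta>) \<longlonglongrightarrow> 0"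
  proof (rule Lim_null_comparison)
    have "cmod (mb_integral N \<zeta>) \<le> 2 * exp (- Re \<zeta> / 4) * B * exp (Re \<zeta>) ^ N" for N
    proof -
      have "exp (mb_line N * Re \<zeta>) = exp (- Re \<zeta> / 4 + real N * Re \<zeta>)" by (simp add: algebra_simps)
      also have "\<dots> = exp (- Re \<zeta> / 4) * exp (Re \<zeta>) ^ N" by (simp only: exp_add exp_of_nat_mult)
      finally show ?thesis
        using mb_integrable(2)[OF assms(1), of N] by (simp only: mult_ac)
    qed
    then show "\<forall>\<^sub>F N in sequentially. cmod (mb_integral N \<zeta>) \<le> 2 * exp (- Re \<zeta> / 4) * B * exp (Re \<zeta>) ^ N"
      by simp
    have "(\<lambda>N. exp (Re \<zeta>) ^ N) \<longlonglongrightarrow> 0"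
      using assms by (intro LIMSEQ_power_zero) simp
    then show "(\<lambda>N. 2 * exp (- Re \<zeta> / 4) * B * exp (Re \<zeta>) ^ N) \<longlonglongrightarrow> 0"
      by (rule tendsto_mult_right_zero)
  qed
  then have "(\<lambda>N. - (mb_integral 0 \<zeta> - mb_integral N \<zeta>) / 2) \<longlonglongrightarrow> - (mb_integral 0 \<zeta> - 0) / 2"
    by (intro tendsto_intros) auto
  then have "(\<lambda>n. b (of_nat n) * (- exp \<zeta>) ^ n) sums mellin_barnes \<zeta>"
    unfolding part sums_def by (simp add: mellin_barnes_def)
  moreover have "(\<lambda>n. b (of_nat n) * (- exp \<zeta>) ^ n) sums node_series (- exp \<zeta>)"
    using assms by (intro series_sums) simp
  ultimately show ?thesis by (rule sums_unique2)
qed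

lemma continuous_mb: "continuous_on {\<zeta>. \<bar>Im \<zeta>\<bar> \<le> pi} mellin_barnes"
  unfolding mellin_barnes_def by (intro continuous_intros continuous_mb_integral) auto

text \<open>
  On Re \<zeta> = 0 the remaining integrals need not tend to 0, so this case is a limit of the previous one.
\<close>

lemma mb_eq_series:
  assumes "\<bar>Im \<zeta>\<bar> \<le> pi" "Re \<zeta> \<le> 0"
  shows "mellin_barnes \<zeta> = node_series (- exp \<zeta>)"
proof -
  define x where "x k = \<zeta> - of_real (inverse (real (Suc k)))" for k
  have x: "\<bar>Im (x k)\<bar> \<le> pi" "Re (x k) < 0" for k
  proof -
    have "0 < inverse (real (Suc k))" by simp
    then show "\<bar>Im (x k)\<bar> \<le> pi" "Re (x k) < 0" using assms unfolding x_def by (simp_all only: minus_complex.sel Re_complex_of_real Im_complex_of_real)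
  qed
  have "(\<lambda>k. complex_of_real (inverse (real (Suc k)))) \<longlonglongrightarrow> of_real 0"
    by (intro tendsto_of_real LIMSEQ_inverse_real_of_nat)
  then have lim: "x \<longlonglongrightarrow> \<zeta>"
    unfolding x_def using tendsto_diff[OF tendsto_const] by force
  have "(\<lambda>k. mellin_barnes (x k)) \<longlonglongrightarrow> mellin_barnes \<zeta>"
    by (rule continuous_on_tendsto_compose[OF continuous_mb lim]) (use assms x in auto)
  moreover have "(\<lambda>k. node_series (- exp (x k))) \<longlonglongrightarrow> node_series (- exp \<zeta>)"
    by (rule continuous_on_tendsto_compose[OF continuous_series])
       (use assms x in \<open>auto intro!: tendsto_intros lim simp: less_imp_le\<close>)
  ultimately show ?thesis
    using mb_eq_series_open[OF x] LIMSEQ_unique by simp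
qed

text \<open>
  The continuation of the power series to the plane cut along [1, \<infinity>). The two formulas agree
  on the closed unit disc away from [0, 1], where Ln (-w) is analytic.
\<close>

definition series_ext :: "complex \<Rightarrow> complex" where
  "series_ext w = (if cmod w \<le> 1 then node_series w else mellin_barnes (Ln (- w)))"

lemma series_ext_eq_mb:
  assumes "exp \<zeta> = - w" "\<bar>Im \<zeta>\<bar> < pi"
  shows "series_ext w = mellin_barnes \<zeta>"
proof -
  have ln: "Ln (- w) = \<zeta>" unfolding assms(1)[symmetric] using assms(2) by (intro Ln_exp) auto
  have "w \<noteq> 0" using assms(1) by (metis exp_not_eq_zero neg_equal_0_iff_equal)
  then have "Re (Ln (- w)) = ln (cmod w)" by (subst Re_Ln) auto
  moreover have "w = - exp \<zeta>" using assms(1) by simp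
  ultimately show ?thesis
    using mb_eq_series[of \<zeta>] assms(2) \<open>w \<noteq> 0\<close> unfolding series_ext_def ln by auto
qed

lemma holomorphic_series_ext: "series_ext holomorphic_on cut_plane"
proof -
  have 1: "series_ext holomorphic_on ball 0 1"
    by (rule holomorphic_transform[OF holomorphic_series]) (simp add: series_ext_def)
  have Ln_Im: "\<bar>Im (Ln (- w))\<bar> < pi" if "- w \<notin> \<real>\<^sub>\<le>\<^sub>0" for w
    using that Im_Ln_less_pi[of "- w"] mpi_less_Im_Ln[of "- w"] by (cases "w = 0") auto
  have 2: "series_ext holomorphic_on {w. - w \<notin> \<real>\<^sub>\<le>\<^sub>0}"
  proof (rule holomorphic_transform)
    have "(mellin_barnes \<circ> (\<lambda>w. Ln (- w))) holomorphic_on {w. - w \<notin> \<real>\<^sub>\<le>\<^sub>0}"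
    proof (rule holomorphic_on_compose_gen)
      show "mellin_barnes holomorphic_on {\<zeta>. \<bar>Im \<zeta>\<bar> < pi}"
        unfolding mellin_barnes_def by (intro holomorphic_intros holomorphic_mb_integral) auto
    qed (use Ln_Im in \<open>auto intro!: holomorphic_intros\<close>)
    then show "(\<lambda>w. mellin_barnes (Ln (- w))) holomorphic_on {w. - w \<notin> \<real>\<^sub>\<le>\<^sub>0}" by (simp add: o_def)
    show "mellin_barnes (Ln (- w)) = series_ext w" if "w \<in> {w. - w \<notin> \<real>\<^sub>\<le>\<^sub>0}" for w
      using that by (intro series_ext_eq_mb[symmetric] Ln_Im exp_Ln) auto
  qed
  have "open {w :: complex. - w \<notin> \<real>\<^sub>\<le>\<^sub>0}"
    using open_vimage[of "- \<real>\<^sub>\<le>\<^sub>0 :: complex set" uminus] closed_nonpos_Reals_complex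
    by (auto simp: vimage_def open_Compl continuous_on_minus)
  then have "series_ext holomorphic_on (ball 0 1 \<union> {w. - w \<notin> \<real>\<^sub>\<le>\<^sub>0})"
    using 1 2 by (intro holomorphic_on_Un) auto
  moreover have "cut_plane \<subseteq> ball 0 1 \<union> {w. - w \<notin> \<real>\<^sub>\<le>\<^sub>0}"
  proof
    fix w assume w: "w \<in> cut_plane"
    show "w \<in> ball 0 1 \<union> {w. - w \<notin> \<real>\<^sub>\<le>\<^sub>0}"
    proof (rule ccontr)
      assume "\<not> ?thesis"
      then have "- w \<in> \<real>\<^sub>\<le>\<^sub>0" "cmod w \<ge> 1" by auto
      then have "w = of_real (Re w)" "Re w \<ge> 1"
        by (auto simp: complex_nonpos_Reals_iff complex_eq_iff cmod_eq_Re)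
      with w show False by (auto simp: cut_plane_def)
    qed
  qed
  ultimately show ?thesis by (rule holomorphic_on_subset)
qed

definition series_bound :: real where "series_bound = (\<Sum>n. cmod (b (of_nat n))) + B"

text \<open>
  On the line Re \<lambda> = -1/4 the kernel carries the factor |w|^(-1/4), which does not exceed 1 outside the
  unit disc. The global bound serves as the dominating function in all later limits.
\<close>

lemma series_ext_bound: "cmod (series_ext w) \<le> series_bound"
proof (cases "cmod w \<le> 1")
  case True
  then show ?thesis using series_norm_le[OF True] B_nonneg by (simp add: series_ext_def series_bound_def)
next
  case False
  then have w: "w \<noteq> 0" by auto
  have "\<bar>Im (Ln (- w))\<bar> \<le> pi" using Im_Ln_le_pi[of "- w"] mpi_less_Im_Ln[of "- w"] w by auto
  then have "cmod (mellin_barnes (Ln (- w))) \<le> exp (mb_line 0 * Re (Ln (- w))) * B"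
    using mb_integrable(2)[of "Ln (- w)" 0] by (simp add: mellin_barnes_def norm_divide)
  also have "\<dots> \<le> 1 * B" using False w by (intro mult_right_mono B_nonneg) auto
  also have "\<dots> \<le> series_bound" unfolding series_bound_def using suminf_nonneg[OF summable_nodes] by simp
  finally show ?thesis using False by (simp add: series_ext_def)
qed

text \<open>
  The edges Im \<zeta> = \<pi> and Im \<zeta> = -\<pi> correspond to the two sides of the cut at e^\<rho>. In the difference of
  the kernels the sine cancels, and what is left is the plain inverse Mellin integral of b.
\<close>

lemma mb_jump:
  "mellin_barnes (Complex \<rho> pi) - mellin_barnes (Complex \<rho> (- pi)) =
     - \<i> * (LINT \<nu>|lborel. b (Complex (-1/4) \<nu>) * exp (Complex (-1/4) \<nu> * of_real \<rho>))"
proof -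
  let ?z = "\<lambda>\<nu>. Complex (mb_line 0) \<nu>"
  have k: "mb_kernel (Complex \<rho> pi) (?z \<nu>) - mb_kernel (Complex \<rho> (- pi)) (?z \<nu>) = 2 * \<i> * exp (?z \<nu> * of_real \<rho>)" for \<nu>
  proof -
    have nz: "sin (of_real pi * ?z \<nu>) \<noteq> 0" by (rule mb_kernel_bound_line(2)[of 0]) simp
    have "exp (?z \<nu> * Complex \<rho> pi) - exp (?z \<nu> * Complex \<rho> (- pi)) = exp (?z \<nu> * of_real \<rho>) * (exp (\<i> * (of_real pi * ?z \<nu>)) - exp (- (\<i> * (of_real pi * ?z \<nu>))))"
      unfolding right_diff_distrib exp_add[symmetric] by (simp add: Complex_eq algebra_simps)
    also have "\<dots> = 2 * \<i> * exp (?z \<nu> * of_real \<rho>) * sin (of_real pi * ?z \<nu>)"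
      by (simp add: sin_exp_eq')
    finally show ?thesis using nz by (simp add: mb_kernel_def flip: diff_divide_distrib)
  qed
  have "mb_integral 0 (Complex \<rho> pi) - mb_integral 0 (Complex \<rho> (- pi))
     = (LINT \<nu>|lborel. b (?z \<nu>) * mb_kernel (Complex \<rho> pi) (?z \<nu>) - b (?z \<nu>) * mb_kernel (Complex \<rho> (- pi)) (?z \<nu>))"
    unfolding mb_integral_def by (rule Bochner_Integration.integral_diff[symmetric]) (intro mb_integrable; simp)+
  also have "\<dots> = (LINT \<nu>|lborel. 2 * \<i> * (b (?z \<nu>) * exp (?z \<nu> * of_real \<rho>)))"
    by (intro Bochner_Integration.integral_cong refl) (simp only: right_diff_distrib[symmetric] k mult_ac)
  also have "\<dots> = 2 * \<i> * (LINT \<nu>|lborel. b (?z \<nu>) * exp (?z \<nu> * of_real \<rho>))"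
    by (rule integral_mult_right_zero)
  finally have "mb_integral 0 (Complex \<rho> pi) - mb_integral 0 (Complex \<rho> (- pi))
     = 2 * \<i> * (LINT \<nu>|lborel. b (?z \<nu>) * exp (?z \<nu> * of_real \<rho>))" .
  moreover have "mellin_barnes (Complex \<rho> pi) - mellin_barnes (Complex \<rho> (- pi))
     = - (mb_integral 0 (Complex \<rho> pi) - mb_integral 0 (Complex \<rho> (- pi))) / 2"
    by (simp add: mellin_barnes_def diff_divide_distrib)
  ultimately show ?thesis by simp
qed

end

section \<open>Laplace's integral for the Legendre polynomials\<close>

lemma pcompose_power: "pcompose (p ^ n) q = pcompose p q ^ n" for p q :: "'a :: comm_ring_1 poly"
  by (induction n) (simp_all add: pcompose_mult pcompose_1)

lemma higher_pderiv_pcompose_shift: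
  "(pderiv ^^ n) (pcompose q [:x, 1:]) = pcompose ((pderiv ^^ n) q) [:x, 1:]"
  for q :: "real poly"
  by (induction n) (simp_all add: pderiv_pcompose pderiv_pCons)

text \<open>
  Rodrigues' formula as a Taylor coefficient: (t^2 - 1)^n at t = x + h is the n-th power of
  x^2 - 1 + 2xh + h^2.
\<close>

lemma poly_legendre_poly_eq_coeff:
  "poly (legendre_poly n) x = coeff ([:x\<^sup>2 - 1, 2 * x, 1:] ^ n) n / 2 ^ n"
proof -
  have "poly ((pderiv ^^ n) ([:-1, 0, 1:] ^ n)) x = coeff (pcompose ((pderiv ^^ n) ([:-1, 0, 1:] ^ n)) [:x, 1:]) 0"
    by (simp add: poly_pcompose flip: poly_0_coeff_0)
  also have "\<dots> = fact n * coeff (pcompose ([:-1, 0, 1:] ^ n) [:x, 1:]) n"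
    by (simp add: coeff_higher_pderiv pochhammer_fact flip: higher_pderiv_pcompose_shift)
  also have "pcompose ([:-1, 0, 1:] ^ n) [:x, 1:] = [:x\<^sup>2 - 1, 2 * x, 1:] ^ n"
    by (simp add: pcompose_power pcompose_pCons power2_eq_square)
  finally show ?thesis by (simp add: legendre_poly_def field_simps)
qed

lemma cos_multiple_has_integral:
  "((\<lambda>\<phi>. cos ((real k - real n) * \<phi>)) has_integral (if k = n then pi else 0)) {0..pi}"
proof (cases "k = n")
  case True
  then show ?thesis using has_integral_const_real[of "1::real" 0 pi] by simp
next
  case False
  define m where "m = real_of_int (int k - int n)"
  have m: "m \<noteq> 0" "real k - real n = m" using False by (auto simp: m_def)
  have "sin (m * pi) = 0" unfolding m_def using sin_npi_int[of "int k - int n"] by (simp only: mult.commute)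
  have "((\<lambda>\<phi>. cos (m * \<phi>)) has_integral (sin (m * pi) / m - sin (m * 0) / m)) {0..pi}"
    by (rule fundamental_theorem_of_calculus)
       (use m in \<open>auto intro!: derivative_eq_intros simp: has_real_derivative_iff_has_vector_derivative[symmetric]\<close>)
  then show ?thesis using False m \<open>sin (m * pi) = 0\<close> by simp
qed

lemma map_poly_of_real_mult:
  "map_poly complex_of_real (p * q) = map_poly of_real p * map_poly of_real q"
  by (rule poly_eqI) (simp add: coeff_map_poly coeff_mult)

text \<open>
  Substituting h = s e^(i\<phi>) with s^2 = x^2 - 1 gives x^2 - 1 + 2xh + h^2 = 2h (x + s cos \<phi>). Hence
  (x + s cos \<phi>)^n is a trigonometric polynomial in \<phi> whose constant term is the
  coefficient found above divided by 2^n, and the integral extracts this constant term.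
\<close>

lemma legendre_poly_laplace_integral:
  fixes x :: real and s :: complex
  assumes s: "s\<^sup>2 = of_real (x\<^sup>2 - 1)" "s \<noteq> 0"
  shows "((\<lambda>\<phi>. (of_real x + s * of_real (cos \<phi>)) ^ n) has_integral of_real (pi * poly (legendre_poly n) x)) {0..pi}"
proof -
  define Q where "Q = [:x\<^sup>2 - 1, 2 * x, 1:] ^ n"
  define C where "C k = of_real (coeff Q k) * s ^ k / (2 * s) ^ n" for k
  have ev: "(\<Sum>k\<le>degree Q. of_real (coeff Q k) * z ^ k) = (of_real (x\<^sup>2 - 1) + 2 * of_real x * z + z\<^sup>2) ^ n" for z :: complex
  proof -
    have "(\<Sum>k\<le>degree Q. of_real (coeff Q k) * z ^ k) = poly (map_poly of_real Q) z"
      by (simp add: poly_altdef coeff_map_poly degree_map_poly)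
    also have "\<dots> = (poly (map_poly of_real [:x\<^sup>2 - 1, 2 * x, 1:]) z) ^ n"
      unfolding Q_def by (induction n) (simp_all only: power_0 power_Suc map_poly_of_real_mult poly_mult map_poly_1' of_real_1 poly_1)
    also have "poly (map_poly of_real [:x\<^sup>2 - 1, 2 * x, 1:]) z = of_real (x\<^sup>2 - 1) + 2 * of_real x * z + z\<^sup>2"
      by (simp add: map_poly_pCons algebra_simps power2_eq_square)
    finally show ?thesis .
  qed
  have one_sided: "(of_real x + s * of_real (cos \<phi>)) ^ n = (\<Sum>k\<le>degree Q. C k * cis ((real k - real n) * \<phi>))" for \<phi>
  proof -
    define e where "e = cis \<phi>"
    have e: "e \<noteq> 0" by (simp add: e_def)
    have "2 * of_real (cos \<phi>) * e = e\<^sup>2 + 1"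
      by (simp add: e_def complex_eq_iff power2_eq_square cis.code cos_squared_eq[unfolded power2_eq_square] algebra_simps)
    then have "2 * of_real x * (s * e) + s\<^sup>2 * (2 * of_real (cos \<phi>) * e) = 2 * of_real x * (s * e) + s\<^sup>2 * (e\<^sup>2 + 1)"
      by simp
    moreover have "2 * s * e * (of_real x + s * of_real (cos \<phi>)) = 2 * of_real x * (s * e) + s\<^sup>2 * (2 * of_real (cos \<phi>) * e)"
      by (simp add: algebra_simps power2_eq_square)
    ultimately have "2 * s * e * (of_real x + s * of_real (cos \<phi>)) = 2 * of_real x * (s * e) + s\<^sup>2 * (e\<^sup>2 + 1)"
      by (simp only:)
    also have "\<dots> = of_real (x\<^sup>2 - 1) + 2 * of_real x * (s * e) + (s * e)\<^sup>2"
      by (simp add: s algebra_simps power_mult_distrib)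
    finally have "(2 * s * e) ^ n * (of_real x + s * of_real (cos \<phi>)) ^ n = (\<Sum>k\<le>degree Q. of_real (coeff Q k) * (s * e) ^ k)"
      unfolding ev by (simp only: power_mult_distrib[symmetric])
    then have "(of_real x + s * of_real (cos \<phi>)) ^ n = (\<Sum>k\<le>degree Q. of_real (coeff Q k) * (s * e) ^ k) / (2 * s * e) ^ n"
      using s e by (simp add: field_simps)
    also have "\<dots> = (\<Sum>k\<le>degree Q. C k * cis ((real k - real n) * \<phi>))"
      unfolding sum_divide_distrib
    proof (rule sum.cong[OF refl])
      fix k
      have "cis ((real k - real n) * \<phi>) = e ^ k / e ^ n"
        unfolding e_def Complex.DeMoivre left_diff_distrib by (rule cis_divide[symmetric])
      then show "of_real (coeff Q k) * (s * e) ^ k / (2 * s * e) ^ n = C k * cis ((real k - real n) * \<phi>)"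
        by (simp add: C_def power_mult_distrib)
    qed
    finally show ?thesis .
  qed
  \<comment> \<open>The left side is even in \<phi>, so averaging over \<phi> and -\<phi> leaves only cosines.\<close>
  have two_sided: "(of_real x + s * of_real (cos \<phi>)) ^ n = (\<Sum>k\<le>degree Q. C k * of_real (cos ((real k - real n) * \<phi>)))" for \<phi>
  proof -
    have "2 * (of_real x + s * of_real (cos \<phi>)) ^ n = (\<Sum>k\<le>degree Q. C k * (cis ((real k - real n) * \<phi>) + cis (- ((real k - real n) * \<phi>))))"
      using one_sided[of \<phi>] one_sided[of "-\<phi>"] by (simp add: sum.distrib distrib_left)
    also have "\<dots> = 2 * (\<Sum>k\<le>degree Q. C k * of_real (cos ((real k - real n) * \<phi>)))"
    proof -
      have "cis m + cis (- m) = 2 * of_real (cos m)" for m by (simp add: complex_eq_iff)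
      then show ?thesis unfolding sum_distrib_left by (simp add: mult_ac)
    qed
    finally show ?thesis by simp
  qed
  have "((\<lambda>\<phi>. \<Sum>k\<le>degree Q. C k * of_real (cos ((real k - real n) * \<phi>))) has_integral
      (\<Sum>k\<le>degree Q. C k * of_real (if k = n then pi else 0))) {0..pi}"
    by (intro has_integral_sum has_integral_mult_right has_integral_of_real cos_multiple_has_integral) auto
  also have "(\<Sum>k\<le>degree Q. C k * of_real (if k = n then pi else 0)) = C n * of_real pi"
    by (auto simp: if_distrib[of of_real] if_distrib[of "(*) _"] sum.delta C_def coeff_eq_0 cong: if_cong)
  also have "C n * of_real pi = of_real (pi * poly (legendre_poly n) x)"
    using s by (simp add: C_def Q_def poly_legendre_poly_eq_coeff power_mult_distrib)
  finally show ?thesis unfolding two_sided .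
qed

section \<open>The Laplace mean on the cut plane\<close>

lemma open_cut_plane: "open cut_plane"
proof -
  have "cut_plane = - ({z. Im z = 0} \<inter> {z. Re z \<ge> 1})"
    by (auto simp: cut_plane_def image_iff complex_eq_iff)
  moreover have "closed ({z. Im z = 0} \<inter> {z. Re z \<ge> 1})"
    by (intro closed_Int closed_halfspace_Re_ge closed_Collect_eq continuous_intros)
  ultimately show ?thesis by (metis open_Compl)
qed

lemma in_cut_plane_iff: "z \<in> cut_plane \<longleftrightarrow> Im z \<noteq> 0 \<or> Re z < 1"
  by (auto simp: cut_plane_def image_iff complex_eq_iff)

lemma connected_cut_plane: "connected cut_plane"
proof -
  have "starlike cut_plane"
    unfolding starlike_def
  proof (intro bexI ballI subsetI)
    show "0 \<in> cut_plane" by (simp add: in_cut_plane_iff)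
    fix z w assume z: "z \<in> cut_plane" and "w \<in> closed_segment 0 z"
    then obtain u where u: "0 \<le> u" "u \<le> 1" "w = of_real u * z"
      by (auto simp: closed_segment_def scaleR_conv_of_real)
    show "w \<in> cut_plane"
    proof (rule ccontr)
      assume "w \<notin> cut_plane"
      then have w: "u * Im z = 0" "u * Re z \<ge> 1" using u by (auto simp: in_cut_plane_iff)
      then have "Im z = 0" by auto
      with z have "Re z < 1" by (simp add: in_cut_plane_iff)
      moreover have "u * Re z \<le> Re z \<or> u * Re z \<le> 0" using u by (cases "Re z \<ge> 0") (auto simp: mult_left_le_one_le mult_nonneg_nonpos)
      ultimately show False using w by auto
    qed
  qed
  then show ?thesis by (rule starlike_imp_connected)
qed

text \<open>
  If z + st = r \<ge> 1 then (r - z)^2 = t^2 (z^2 - 1). The imaginary part of this equation forces z to be real,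
  and for real z < 1 the two sides have incompatible sizes. So the points at which the
  continued power series is evaluated never meet its cut.
\<close>

lemma laplace_segment_in_cut_plane:
  assumes z: "z \<in> cut_plane" and s: "s\<^sup>2 = z\<^sup>2 - 1" and t: "\<bar>t\<bar> \<le> 1"
  shows "z + s * of_real t \<in> cut_plane"
proof (rule ccontr)
  assume "z + s * of_real t \<notin> cut_plane"
  then obtain r where r: "r \<ge> 1" "z + s * of_real t = of_real r"
    by (auto simp: cut_plane_def)
  define x y where "x = Re z" and "y = Im z"
  have zxy: "z = Complex x y" by (simp add: x_def y_def)
  have t2: "t\<^sup>2 \<le> 1" using t by (simp add: abs_square_le_1)
  have "(of_real r - z)\<^sup>2 = (s * of_real t)\<^sup>2" using r(2) by (metis add_diff_cancel_left')
  also have "\<dots> = of_real (t\<^sup>2) * (z\<^sup>2 - 1)" by (simp add: power_mult_distrib s mult.commute)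
  finally have eq: "(of_real r - z)\<^sup>2 = of_real (t\<^sup>2) * (z\<^sup>2 - 1)" .
  have re: "(r - x)\<^sup>2 - y\<^sup>2 = t\<^sup>2 * (x\<^sup>2 - y\<^sup>2 - 1)"
    using arg_cong[OF eq, of Re] by (simp add: zxy power2_eq_square)
  have im: "(r - x) * y = - (t\<^sup>2 * (x * y))"
    using arg_cong[OF eq, of Im] by (simp add: zxy power2_eq_square algebra_simps)
  have y0: "y = 0"
  proof (rule ccontr)
    assume y: "y \<noteq> 0"
    have "(r - x + t\<^sup>2 * x) * y = 0" using im by (simp add: algebra_simps)
    then have "r - x + t\<^sup>2 * x = 0" using y by (simp only: mult_eq_0_iff) simp
    then have rx: "r = (1 - t\<^sup>2) * x" by (simp add: algebra_simps)
    then have q: "1 - t\<^sup>2 \<noteq> 0" using r by auto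
    have "(1 - t\<^sup>2) * ((r - x)\<^sup>2 - y\<^sup>2) = (1 - t\<^sup>2) * (t\<^sup>2 * (x\<^sup>2 - y\<^sup>2 - 1))" using re by simp
    then have "((1 - t\<^sup>2) * y)\<^sup>2 = t\<^sup>2 * (1 - t\<^sup>2 - r\<^sup>2)"
      unfolding rx by (simp add: power2_eq_square algebra_simps)
    also have "\<dots> \<le> 0"
    proof -
      have "1 \<le> r\<^sup>2" using r by simp
      moreover have "0 \<le> t\<^sup>2" by simp
      ultimately have "1 - t\<^sup>2 - r\<^sup>2 \<le> 0" by linarith
      then show ?thesis by (intro mult_nonneg_nonpos) auto
    qed
    finally show False using q y by simp
  qed
  with z have x: "x < 1" by (auto simp: in_cut_plane_iff x_def y_def)
  have main: "(r - x)\<^sup>2 = t\<^sup>2 * (x\<^sup>2 - 1)" using re y0 by simp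
  show False
  proof (cases "x \<ge> -1")
    case True
    then have "x\<^sup>2 \<le> 1" using x by (simp add: abs_square_le_1)
    then have "t\<^sup>2 * (x\<^sup>2 - 1) \<le> 0" by (intro mult_nonneg_nonpos) auto
    moreover have "(r - x)\<^sup>2 > 0" using x r by simp
    ultimately show False using main by simp
  next
    case False
    then have "1 \<le> x\<^sup>2" using power_mono[of 1 "- x" 2] by simp
    then have "t\<^sup>2 * (x\<^sup>2 - 1) \<le> 1 * (x\<^sup>2 - 1)" using t2 by (intro mult_right_mono) auto
    moreover have "(r - x)\<^sup>2 > x\<^sup>2"
      using False r by (simp add: power2_eq_square algebra_simps)
    ultimately show False using main by simp
  qed
qed

context summable_line_integrable begin

text \<open>
  Averaging the generating function of the b(n) along Laplace's path turns each power w^n into a Legendre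
  polynomial. The argument s stands for either square root of z^2 - 1.
\<close>

definition laplace_mean :: "complex \<Rightarrow> complex \<Rightarrow> complex" where
  "laplace_mean z s = integral {0..pi} (\<lambda>\<phi>. series_ext (z + s * of_real (cos \<phi>))) / of_real pi"

lemma continuous_laplace_integrand:
  assumes "z \<in> cut_plane" "s\<^sup>2 = z\<^sup>2 - 1"
  shows "continuous_on {0..pi} (\<lambda>\<phi>. series_ext (z + s * of_real (cos \<phi>)))"
  by (rule continuous_on_compose2[OF holomorphic_on_imp_continuous_on[OF holomorphic_series_ext]])
     (auto intro!: continuous_intros laplace_segment_in_cut_plane assms)

text \<open>
  The reflection \<phi> \<mapsto> \<pi> - \<phi> changes the sign of the cosine, so the choice of the square root is immaterial.
\<close>

lemma laplace_mean_minus: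
  assumes "z \<in> cut_plane" "s\<^sup>2 = z\<^sup>2 - 1"
  shows "laplace_mean z (- s) = laplace_mean z s"
proof -
  let ?f = "\<lambda>\<phi>. series_ext (z + s * of_real (cos \<phi>))"
  have "(?f has_integral integral {0..pi} ?f) (cbox 0 pi)"
    using integrable_continuous_interval[OF continuous_laplace_integrand[OF assms]] by (simp add: integrable_integral)
  then have "((\<lambda>\<phi>. ?f (-1 *\<^sub>R \<phi> + pi)) has_integral (1 / \<bar>-1\<bar> ^ DIM(real)) *\<^sub>R integral {0..pi} ?f)
       ((\<lambda>x. (1 / -1) *\<^sub>R x + - ((1 / -1) *\<^sub>R pi)) ` cbox 0 pi)"
    by (rule has_integral_affinity) simp
  moreover have "(\<lambda>x. (1 / -1) *\<^sub>R x + - ((1 / -1) *\<^sub>R pi)) ` cbox 0 pi = {0..pi}"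
    using image_affinity_atLeastAtMost[of "-1::real" pi 0 pi] by simp
  ultimately have "((\<lambda>\<phi>. series_ext (z + (- s) * of_real (cos \<phi>))) has_integral integral {0..pi} ?f) {0..pi}"
    by (simp add: cos_diff)
  then show ?thesis by (simp add: laplace_mean_def integral_unique)
qed

lemma laplace_mean_cong:
  assumes "z \<in> cut_plane" "s\<^sup>2 = z\<^sup>2 - 1" "s'\<^sup>2 = z\<^sup>2 - 1"
  shows "laplace_mean z s = laplace_mean z s'"
proof -
  have "s' = s \<or> s' = - s" using assms by (simp flip: power2_eq_iff)
  then show ?thesis using laplace_mean_minus[OF assms(1,2)] by auto
qed

lemma laplace_mean_bound:
  assumes "z \<in> cut_plane" "s\<^sup>2 = z\<^sup>2 - 1"
  shows "cmod (laplace_mean z s) \<le> series_bound"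
proof -
  have "cmod (integral {0..pi} (\<lambda>\<phi>. series_ext (z + s * of_real (cos \<phi>)))) \<le> series_bound * (pi - 0)"
    by (rule integral_bound) (use continuous_laplace_integrand[OF assms] series_ext_bound in auto)
  then show ?thesis by (simp add: laplace_mean_def norm_divide divide_le_eq)
qed

lemma holomorphic_laplace_mean:
  assumes U: "open U" "U \<subseteq> cut_plane" and s: "s holomorphic_on U" "\<And>z. z \<in> U \<Longrightarrow> (s z)\<^sup>2 = z\<^sup>2 - 1"
  shows "(\<lambda>z. laplace_mean z (s z)) holomorphic_on U"
proof -
  have ball: "(\<lambda>z. integral (cbox 0 pi) (\<lambda>\<phi>. series_ext (z + s z * of_real (cos \<phi>)))) holomorphic_on ball x e"
    if sub: "ball x e \<subseteq> U" for x e
  proof (rule leibniz_rule_holomorphic[where fx = "\<lambda>z \<phi>. deriv series_ext (z + s z * of_real (cos \<phi>)) * (1 + deriv s z * of_real (cos \<phi>))"])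
    fix z and \<phi> :: real assume z: "z \<in> ball x e"
    have 1: "((\<lambda>z. z + s z * of_real (cos \<phi>)) has_field_derivative (1 + deriv s z * of_real (cos \<phi>))) (at z within ball x e)"
      using z sub by (auto intro!: derivative_eq_intros holomorphic_derivI[OF s(1) U(1)])
    have mem: "z + s z * of_real (cos \<phi>) \<in> cut_plane"
      using z sub U s by (intro laplace_segment_in_cut_plane) auto
    have 2: "(series_ext has_field_derivative deriv series_ext (z + s z * of_real (cos \<phi>))) (at (z + s z * of_real (cos \<phi>)) within (\<lambda>z. z + s z * of_real (cos \<phi>)) ` ball x e)"
      by (rule holomorphic_derivI[OF holomorphic_series_ext open_cut_plane mem])
    show "((\<lambda>z. series_ext (z + s z * of_real (cos \<phi>))) has_field_derivative deriv series_ext (z + s z * of_real (cos \<phi>)) * (1 + deriv s z * of_real (cos \<phi>))) (at z within ball x e)"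
      using DERIV_image_chain[OF 2 1] by (simp add: o_def)
  next
    fix z assume z: "z \<in> ball x e"
    show "(\<lambda>\<phi>. series_ext (z + s z * of_real (cos \<phi>))) integrable_on cbox 0 pi"
      unfolding cbox_interval
      by (intro integrable_continuous_interval continuous_laplace_integrand) (use z sub U s in auto)
  next
    have cs: "continuous_on (ball x e) s"
      by (rule holomorphic_on_imp_continuous_on[OF holomorphic_on_subset[OF s(1) sub]])
    have cd: "continuous_on (ball x e) (deriv s)"
      using holomorphic_on_imp_continuous_on[OF holomorphic_deriv[OF s(1) U(1)]] sub by (rule continuous_on_subset)
    have cg: "continuous_on cut_plane (deriv series_ext)"
      using holomorphic_on_imp_continuous_on[OF holomorphic_deriv[OF holomorphic_series_ext open_cut_plane]] .
    have cs2: "continuous_on (ball x e \<times> cbox 0 pi) (\<lambda>p. s (fst p))"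
      by (rule continuous_on_compose2[OF cs]) (auto intro!: continuous_intros)
    have cd2: "continuous_on (ball x e \<times> cbox 0 pi) (\<lambda>p. deriv s (fst p))"
      by (rule continuous_on_compose2[OF cd]) (auto intro!: continuous_intros)
    have "continuous_on (ball x e \<times> cbox 0 pi) (\<lambda>p. deriv series_ext (fst p + s (fst p) * of_real (cos (snd p))))"
    proof (rule continuous_on_compose2[OF cg])
      show "continuous_on (ball x e \<times> cbox 0 pi) (\<lambda>p. fst p + s (fst p) * of_real (cos (snd p)))"
        by (intro continuous_intros cs2)
      show "(\<lambda>p. fst p + s (fst p) * of_real (cos (snd p))) ` (ball x e \<times> cbox 0 pi) \<subseteq> cut_plane"
        using sub U s by (auto intro!: laplace_segment_in_cut_plane)
    qed
    then show "continuous_on (ball x e \<times> cbox 0 pi) (\<lambda>(z, \<phi>). deriv series_ext (z + s z * of_real (cos \<phi>)) * (1 + deriv s z * of_real (cos \<phi>)))"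
      unfolding case_prod_unfold by (intro continuous_intros cd2)
  qed simp
  have "(\<lambda>z. laplace_mean z (s z)) analytic_on U"
    unfolding analytic_on_def
  proof
    fix x assume "x \<in> U"
    then obtain e where e: "e > 0" "ball x e \<subseteq> U" using U(1) by (meson open_contains_ball)
    have "(\<lambda>z. laplace_mean z (s z)) holomorphic_on ball x e"
      unfolding laplace_mean_def using ball[OF e(2)] by (intro holomorphic_intros) auto
    with e show "\<exists>e>0. (\<lambda>z. laplace_mean z (s z)) holomorphic_on ball x e" by blast
  qed
  then show ?thesis by (rule analytic_imp_holomorphic)
qed

text \<open>
  The branches csqrt (z^2 - 1) and i csqrt (1 - z^2) are analytic on open sets that together cover
  the cut plane except for the branch point -1. As the mean is bounded, the singularity
  at -1 is removable.
\<close>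

lemma laplace_mean_extension:
  obtains g where "g holomorphic_on cut_plane"
    "\<And>z s. z \<in> cut_plane \<Longrightarrow> z \<noteq> -1 \<Longrightarrow> s\<^sup>2 = z\<^sup>2 - 1 \<Longrightarrow> g z = laplace_mean z s"
proof -
  define g0 where "g0 z = laplace_mean z (csqrt (z\<^sup>2 - 1))" for z
  define U1 where "U1 = cut_plane \<inter> {z. z\<^sup>2 - 1 \<notin> \<real>\<^sub>\<le>\<^sub>0}"
  define U2 where "U2 = cut_plane \<inter> {z. 1 - z\<^sup>2 \<notin> \<real>\<^sub>\<le>\<^sub>0}"
  have op: "open {z. h z \<notin> \<real>\<^sub>\<le>\<^sub>0}" if "continuous_on UNIV h" for h :: "complex \<Rightarrow> complex"
    using open_vimage[of "- \<real>\<^sub>\<le>\<^sub>0 :: complex set" h] that closed_nonpos_Reals_complex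
    by (auto simp: vimage_def open_Compl)
  have open1: "open U1" unfolding U1_def by (intro open_Int open_cut_plane op continuous_intros)
  have open2: "open U2" unfolding U2_def by (intro open_Int open_cut_plane op continuous_intros)
  have g0: "g0 z = laplace_mean z s" if "z \<in> cut_plane" "s\<^sup>2 = z\<^sup>2 - 1" for z s
    unfolding g0_def using that by (intro laplace_mean_cong) auto
  have h1: "g0 holomorphic_on U1"
    unfolding g0_def
    by (rule holomorphic_laplace_mean[OF open1]) (auto simp: U1_def intro!: holomorphic_intros)
  have "(\<lambda>z. laplace_mean z (\<i> * csqrt (1 - z\<^sup>2))) holomorphic_on U2"
    by (rule holomorphic_laplace_mean[OF open2]) (auto simp: U2_def power_mult_distrib intro!: holomorphic_intros)
  then have h2: "g0 holomorphic_on U2"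
    by (rule holomorphic_transform) (auto simp: U2_def power_mult_distrib intro!: g0[symmetric])
  have "cut_plane - {-1} \<subseteq> U1 \<union> U2"
  proof
    fix z assume z: "z \<in> cut_plane - {-1}"
    show "z \<in> U1 \<union> U2"
    proof (rule ccontr)
      assume "z \<notin> U1 \<union> U2"
      then have "z\<^sup>2 - 1 \<in> \<real>\<^sub>\<le>\<^sub>0" "1 - z\<^sup>2 \<in> \<real>\<^sub>\<le>\<^sub>0" using z by (auto simp: U1_def U2_def)
      then have "z\<^sup>2 = 1" by (auto simp: complex_nonpos_Reals_iff complex_eq_iff)
      then have "z = 1 \<or> z = -1" by (simp add: power2_eq_1_iff)
      with z show False by (auto simp: in_cut_plane_iff)
    qed
  qed
  then have hol: "g0 holomorphic_on cut_plane - {-1}"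
    using holomorphic_on_Un[OF h1 h2 open1 open2] holomorphic_on_subset by blast
  have int: "-1 \<in> interior cut_plane"
    using open_cut_plane by (simp add: interior_open in_cut_plane_iff)
  have "cmod (g0 z) \<le> series_bound" if "z \<in> cut_plane" for z
    unfolding g0_def using that by (intro laplace_mean_bound) auto
  moreover have "\<forall>\<^sub>F z in at (-1). z \<in> cut_plane"
    by (rule eventually_at_in_open'[OF open_cut_plane]) (simp add: in_cut_plane_iff)
  ultimately have "\<forall>\<^sub>F z in at (-1). cmod (g0 z) \<le> series_bound"
    by (auto elim!: eventually_mono)
  then obtain g where g: "g holomorphic_on cut_plane" "\<forall>z \<in> cut_plane - {-1}. g z = g0 z"
    using holomorphic_on_extend_bounded[OF hol int] by blast
  show ?thesis by (rule that[OF g(1)]) (use g(2) g0 in auto)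
qed

lemma legendre_series_sums_laplace_mean:
  fixes x :: real
  assumes x: "\<bar>x\<bar> < 1" and s: "s\<^sup>2 = of_real (x\<^sup>2 - 1)"
  shows "(\<lambda>n. b (of_nat n) * of_real (poly (legendre_poly n) x)) sums laplace_mean (of_real x) s"
proof -
  have x2: "x\<^sup>2 < 1" using x by (simp add: abs_square_less_1)
  have s0: "s \<noteq> 0" using s x2 by (auto simp: complex_eq_iff)
  define h where "h \<phi> = of_real x + s * of_real (cos \<phi>)" for \<phi> :: real
  have h1: "cmod (h \<phi>) \<le> 1" for \<phi>
  proof -
    have "Re s * Im s = 0" "(Re s)\<^sup>2 - (Im s)\<^sup>2 = x\<^sup>2 - 1"
      using s by (auto simp: complex_eq_iff power2_eq_square)
    then have im: "Re s = 0" "(Im s)\<^sup>2 = 1 - x\<^sup>2"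
      using x2 by (auto simp: algebra_simps) (smt (verit) zero_le_power2)+
    have cos_squared_le: "(cos \<phi>)\<^sup>2 \<le> 1" by (simp add: abs_square_le_1)
    have "(cmod (h \<phi>))\<^sup>2 = x\<^sup>2 + (1 - x\<^sup>2) * (cos \<phi>)\<^sup>2"
      by (simp add: h_def cmod_power2 im power_mult_distrib)
    also have "\<dots> \<le> x\<^sup>2 + (1 - x\<^sup>2) * 1"
      using x2 cos_squared_le by (intro add_left_mono mult_left_mono) auto
    finally show ?thesis using power2_le_imp_le[of "cmod (h \<phi>)" 1] by simp
  qed
  have ul: "uniform_limit {0..pi} (\<lambda>N \<phi>. \<Sum>n<N. b (of_nat n) * h \<phi> ^ n) (\<lambda>\<phi>. node_series (h \<phi>)) sequentially"
    by (rule uniform_limit_compose'[OF series_uniform_limit]) (use h1 in auto)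
  have ct: "continuous_on {0..pi} (\<lambda>\<phi>. \<Sum>n<N. b (of_nat n) * h \<phi> ^ n)" for N
    unfolding h_def by (intro continuous_intros)
  obtain I J where IJ: "\<And>N. ((\<lambda>\<phi>. \<Sum>n<N. b (of_nat n) * h \<phi> ^ n) has_integral I N) {0..pi}"
    "((\<lambda>\<phi>. node_series (h \<phi>)) has_integral J) {0..pi}" "I \<longlonglongrightarrow> J"
    using uniform_limit_integral[OF ul ct] by auto
  have "((\<lambda>\<phi>. \<Sum>n<N. b (of_nat n) * h \<phi> ^ n) has_integral (\<Sum>n<N. b (of_nat n) * of_real (pi * poly (legendre_poly n) x))) {0..pi}" for N
    unfolding h_def by (intro has_integral_sum has_integral_mult_right legendre_poly_laplace_integral s s0) auto
  then have I: "I = (\<lambda>N. \<Sum>n<N. b (of_nat n) * of_real (pi * poly (legendre_poly n) x))"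
    using IJ(1) has_integral_unique by blast
  have "(\<lambda>n. b (of_nat n) * of_real (pi * poly (legendre_poly n) x) / of_real pi) sums (J / of_real pi)"
    using IJ(3) unfolding I by (intro sums_divide) (simp add: sums_def)
  also have "J / of_real pi = laplace_mean (of_real x) s"
    using integral_unique[OF IJ(2)] h1 unfolding laplace_mean_def series_ext_def h_def by simp
  finally show ?thesis by simp
qed

end

section \<open>Boundary values and the jump across the cut\<close>

lemma cos_Complex: "cos (Complex u v) = Complex (cos u * cosh v) (- (sin u * sinh v))"
  by (simp add: complex_eq_iff Re_cos Im_cos cosh_field_def sinh_field_def)
     (simp add: algebra_simps)

lemma sin_Complex: "sin (Complex u v) = Complex (sin u * cosh v) (cos u * sinh v)"
  by (simp add: complex_eq_iff Re_sin Im_sin cosh_field_def sinh_field_def)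

lemma minus_i_sin_squared: "(- \<i> * sin z)\<^sup>2 = (cos z)\<^sup>2 - 1" for z :: complex
  using sin_squared_eq[of z] by (simp add: power_mult_distrib)

text \<open>
  The points cosh v + sinh v cos \<phi> are the limits of Laplace's path as z tends to cosh v; they are the bases
  of the powers in the definition of the Legendre function.
\<close>

lemma cosh_add_sinh_cos_pos: "0 < cosh v + sinh v * cos \<phi>" for v \<phi> :: real
proof -
  have "\<bar>sinh v * cos \<phi>\<bar> \<le> \<bar>sinh v\<bar> * 1" unfolding abs_mult by (intro mult_left_mono) auto
  moreover have "\<bar>sinh v\<bar> < cosh v"
    using sinh_less_cosh_real[of v] sinh_less_cosh_real[of "-v"] by (auto simp: abs_if)
  ultimately show ?thesis by linarith
qed

context summable_line_integrable begin

text \<open>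
  The boundary value of the continued power series at r = cosh v + sinh v cos \<phi>, taken at the edge
  Im \<zeta> = \<epsilon> \<pi>. The sign \<epsilon> is that of u in \<theta> = u + iv; for v > 0 the points of Laplace's path
  that approach the cut do so from below for \<epsilon> = 1 and from above for \<epsilon> = -1.
\<close>

definition boundary_integrand :: "real \<Rightarrow> real \<Rightarrow> real \<Rightarrow> complex" where
  "boundary_integrand \<epsilon> v \<phi> = mellin_barnes (Complex (ln (cosh v + sinh v * cos \<phi>)) (\<epsilon> * pi))"

lemma mb_on_real_axis:
  assumes "0 < r" "r \<le> 1" "\<epsilon> = 1 \<or> \<epsilon> = -1"
  shows "mellin_barnes (Complex (ln r) (\<epsilon> * pi)) = node_series (of_real r)"
proof -
  have "exp (Complex (ln r) (\<epsilon> * pi)) = - of_real r"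
    using assms by (auto simp: exp_eq_polar complex_eq_iff)
  then show ?thesis using assms by (subst mb_eq_series) auto
qed

lemma series_ext_tendsto_inside:
  assumes w: "(w \<longlongrightarrow> of_real r) F" and in_ball: "\<forall>\<^sub>F x in F. cmod (w x) \<le> 1"
    and r: "0 < r" "r \<le> 1" and \<epsilon>: "\<epsilon> = 1 \<or> \<epsilon> = -1"
  shows "((\<lambda>x. series_ext (w x)) \<longlongrightarrow> mellin_barnes (Complex (ln r) (\<epsilon> * pi))) F"
proof -
  have "((\<lambda>x. node_series (w x)) \<longlongrightarrow> node_series (of_real r)) F"
    by (rule continuous_on_tendsto_compose[OF continuous_series w]) (use r in_ball in auto)
  then show ?thesis
    unfolding mb_on_real_axis[OF r \<epsilon>]
    by (rule Lim_transform_eventually) (use in_ball in eventually_elim, simp add: series_ext_def)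
qed

lemma series_ext_tendsto_side:
  assumes w: "(w \<longlongrightarrow> of_real r) F" and side: "\<forall>\<^sub>F x in F. \<epsilon> * Im (w x) < 0"
    and r: "0 < r" and \<epsilon>: "\<epsilon> = 1 \<or> \<epsilon> = -1"
  shows "((\<lambda>x. series_ext (w x)) \<longlongrightarrow> mellin_barnes (Complex (ln r) (\<epsilon> * pi))) F"
proof -
  have "((\<lambda>x. Ln (w x) + \<i> * of_real (\<epsilon> * pi)) \<longlongrightarrow> Ln (of_real r) + \<i> * of_real (\<epsilon> * pi)) F"
    using r by (intro tendsto_intros w) auto
  also have "Ln (of_real r) + \<i> * of_real (\<epsilon> * pi) = Complex (ln r) (\<epsilon> * pi)"
    using r by (simp add: Ln_of_real Complex_eq)
  finally have lim: "((\<lambda>x. Ln (w x) + \<i> * of_real (\<epsilon> * pi)) \<longlongrightarrow> Complex (ln r) (\<epsilon> * pi)) F" .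
  have strip: "\<bar>Im (Ln z + \<i> * of_real (\<epsilon> * pi))\<bar> < pi \<and> series_ext z = mellin_barnes (Ln z + \<i> * of_real (\<epsilon> * pi))"
    if z: "\<epsilon> * Im z < 0" for z
  proof -
    have z0: "z \<noteq> 0" using z by auto
    have "\<bar>Im (Ln z + \<i> * of_real (\<epsilon> * pi))\<bar> < pi"
    proof (cases "\<epsilon> = 1")
      case True
      then have "Im z < 0" using z by simp
      then have "Im (Ln z) < 0" "- pi < Im (Ln z)"
        using Im_Ln_pos_le[OF z0] mpi_less_Im_Ln[OF z0] Im_Ln_le_pi[OF z0] by (auto simp: not_le)
      then show ?thesis using True by simp
    next
      case False
      then have "0 < Im z" "\<epsilon> = -1" using z \<epsilon> by auto
      then show ?thesis using Im_Ln_pos_lt_imp[of z] by simp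
    qed
    moreover have "exp (Ln z + \<i> * of_real (\<epsilon> * pi)) = - z"
      using z0 \<epsilon> by (auto simp: exp_add exp_minus)
    ultimately show ?thesis using series_ext_eq_mb by blast
  qed
  have "((\<lambda>x. mellin_barnes (Ln (w x) + \<i> * of_real (\<epsilon> * pi))) \<longlongrightarrow> mellin_barnes (Complex (ln r) (\<epsilon> * pi))) F"
  proof (rule continuous_on_tendsto_compose[OF continuous_mb lim])
    show "\<forall>\<^sub>F x in F. Ln (w x) + \<i> * of_real (\<epsilon> * pi) \<in> {\<zeta>. \<bar>Im \<zeta>\<bar> \<le> pi}"
      using side by eventually_elim (use strip in force)
  qed (use \<epsilon> in auto)
  then show ?thesis
    by (rule Lim_transform_eventually) (use side in eventually_elim, use strip in force)
qed

text \<open>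
  With z = cos \<theta> and s = -i sin \<theta>, the point w on Laplace's path has imaginary part
  -\<epsilon> sin u (sinh v + t cosh v), where t = cos \<phi>. If r < 1 the limit lies inside the disc of convergence and the
  side does not matter. If r \<ge> 1 and v > 0 then t sinh v \<ge> 1 - cosh v, which makes
  sinh v + t cosh v positive, so the side of approach is the one given by \<epsilon>. For v = 0 the whole
  path stays in the closed unit disc.
\<close>

lemma series_ext_boundary_limit:
  assumes \<epsilon>: "\<epsilon> = 1 \<or> \<epsilon> = -1" and v: "0 \<le> v"
  shows "((\<lambda>u. series_ext (cos (Complex (\<epsilon> * u) v) + (- \<i> * sin (Complex (\<epsilon> * u) v)) * of_real (cos \<phi>)))
     \<longlongrightarrow> boundary_integrand \<epsilon> v \<phi>) (at_right 0)"
proof -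
  define t where "t = cos \<phi>"
  define r where "r = cosh v + sinh v * t"
  define w where "w u = cos (Complex (\<epsilon> * u) v) + (- \<i> * sin (Complex (\<epsilon> * u) v)) * of_real t" for u
  have r0: "0 < r" unfolding r_def t_def by (rule cosh_add_sinh_cos_pos)
  have weq: "w u = Complex (cos u * r) (- \<epsilon> * (sin u * (sinh v + cosh v * t)))" for u
    using \<epsilon> by (auto simp: w_def r_def cos_Complex sin_Complex complex_eq_iff algebra_simps)
  have "((\<lambda>u. w u) \<longlongrightarrow> Complex (cos 0 * r) (- \<epsilon> * (sin 0 * (sinh v + cosh v * t)))) (at_right 0)"
    unfolding weq by (intro tendsto_intros)
  then have lim: "(w \<longlongrightarrow> of_real r) (at_right 0)" by (simp add: complex_of_real_def)
  have "((\<lambda>u. series_ext (w u)) \<longlongrightarrow> mellin_barnes (Complex (ln r) (\<epsilon> * pi))) (at_right 0)"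
  proof (cases "r < 1 \<or> v = 0")
    case True
    then have "\<forall>\<^sub>F u in at_right 0. cmod (w u) \<le> 1"
    proof
      assume "r < 1"
      then have "\<forall>\<^sub>F u in at_right 0. cmod (w u) < 1"
        using r0 by (intro order_tendstoD(2)[OF tendsto_norm[OF lim]]) auto
      then show ?thesis by eventually_elim simp
    next
      assume v0: "v = 0"
      have "cmod (w u) \<le> 1" for u
      proof (rule power2_le_imp_le)
        have "(cmod (w u))\<^sup>2 = (cos u)\<^sup>2 + (sin u)\<^sup>2 * t\<^sup>2"
          using \<epsilon> v0 by (auto simp: weq cmod_power2 r_def power_mult_distrib)
        also have "\<dots> \<le> (cos u)\<^sup>2 + (sin u)\<^sup>2 * 1"
          by (intro add_left_mono mult_left_mono) (simp_all add: t_def abs_square_le_1)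
        finally show "(cmod (w u))\<^sup>2 \<le> 1\<^sup>2" by simp
      qed simp
      then show ?thesis by simp
    qed
    moreover have "r \<le> 1" using True by (auto simp: r_def)
    ultimately show ?thesis by (intro series_ext_tendsto_inside[OF lim]) (use r0 \<epsilon> in auto)
  next
    case False
    then have r1: "r \<ge> 1" and v0: "v > 0" using v by auto
    have "cosh v > 1" using cosh_real_strict_mono[of 0 v] v0 by simp
    have "(sinh v + cosh v * t) * sinh v = (sinh v)\<^sup>2 + cosh v * (r - cosh v)"
      by (simp add: r_def algebra_simps power2_eq_square)
    also have "\<dots> \<ge> (sinh v)\<^sup>2 + cosh v * (1 - cosh v)"
      using r1 by (intro add_left_mono mult_left_mono) auto
    also have "(sinh v)\<^sup>2 + cosh v * (1 - cosh v) = cosh v - 1"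
      using cosh_square_eq[of v] by (simp add: algebra_simps power2_eq_square)
    finally have "(sinh v + cosh v * t) * sinh v > 0" using \<open>cosh v > 1\<close> by linarith
    then have pos: "sinh v + cosh v * t > 0" using v0 by (simp add: zero_less_mult_iff)
    have "\<forall>\<^sub>F u in at_right (0::real). u \<in> {0<..<pi}"
      using eventually_at_right_real[OF pi_gt_zero] .
    then have "\<forall>\<^sub>F u in at_right 0. \<epsilon> * Im (w u) < 0"
    proof eventually_elim
      case (elim u)
      then have "sin u > 0" by (intro sin_gt_zero) auto
      then show ?case using pos \<epsilon> by (auto simp: weq)
    qed
    then show ?thesis by (intro series_ext_tendsto_side[OF lim]) (use r0 \<epsilon> in auto)
  qed
  then show ?thesis by (simp add: w_def boundary_integrand_def r_def t_def)
qed

lemma laplace_mean_boundary_limit: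
  assumes \<epsilon>: "\<epsilon> = 1 \<or> \<epsilon> = -1" and v: "0 \<le> v"
  shows "((\<lambda>u. laplace_mean (cos (Complex (\<epsilon> * u) v)) (- \<i> * sin (Complex (\<epsilon> * u) v)))
     \<longlongrightarrow> integral {0..pi} (boundary_integrand \<epsilon> v) / of_real pi) (at_right 0)"
    and "boundary_integrand \<epsilon> v integrable_on {0..pi}"
proof -
  define h where "h u \<phi> = series_ext (cos (Complex (\<epsilon> * u) v) + (- \<i> * sin (Complex (\<epsilon> * u) v)) * of_real (cos \<phi>))" for u \<phi>
  have cut: "cos (Complex (\<epsilon> * u) v) \<in> cut_plane" if u: "u \<in> {0<..<pi}" for u
  proof (cases "v = 0")
    case True
    have "cos u < cos 0" using u by (intro cos_monotone_0_pi) auto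
    then show ?thesis using True \<epsilon> by (auto simp: in_cut_plane_iff cos_Complex)
  next
    case False
    have "sin u > 0" using u by (intro sin_gt_zero) auto
    then show ?thesis using False v \<epsilon> by (auto simp: in_cut_plane_iff cos_Complex)
  qed
  have int: "h u integrable_on {0..pi}" if "u \<in> {0<..<pi}" for u
    unfolding h_def[abs_def]
    by (intro integrable_continuous_interval continuous_laplace_integrand cut minus_i_sin_squared that)
  have dom: "(\<lambda>k. integral {0..pi} (h (X k))) \<longlonglongrightarrow> integral {0..pi} (boundary_integrand \<epsilon> v)
       \<and> boundary_integrand \<epsilon> v integrable_on {0..pi}"
    if X: "\<And>k. X k \<in> {0<..<pi}" "X \<longlonglongrightarrow> 0" for X
  proof -
    have "filterlim X (at_right 0) sequentially"
    proof -
      have "0 < X k" for k using X(1)[of k] by simp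
      then show ?thesis using X(2) by (auto simp: filterlim_at less_imp_neq[THEN not_sym])
    qed
    then have lim: "(\<lambda>k. h (X k) \<phi>) \<longlonglongrightarrow> boundary_integrand \<epsilon> v \<phi>" for \<phi>
      unfolding h_def by (rule filterlim_compose[OF series_ext_boundary_limit[OF \<epsilon> v]])
    show ?thesis
      using dominated_convergence[where f = "\<lambda>k. h (X k)" and h = "\<lambda>_. series_bound" and S = "{0..pi}" and g = "boundary_integrand \<epsilon> v"]
        int X(1) lim series_ext_bound by (auto simp: h_def)
  qed
  have at: "at 0 within {0<..<pi} = at_right (0::real)"
    by (rule at_within_nhd[of _ "{..<pi}"]) auto
  have "((\<lambda>u. integral {0..pi} (h u)) \<longlongrightarrow> integral {0..pi} (boundary_integrand \<epsilon> v)) (at_right 0)"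
    unfolding at[symmetric] tendsto_at_iff_sequentially using dom by (auto simp: o_def)
  then have "((\<lambda>u. integral {0..pi} (h u) / of_real pi) \<longlongrightarrow> integral {0..pi} (boundary_integrand \<epsilon> v) / of_real pi) (at_right 0)"
    by (intro tendsto_intros) auto
  then show "((\<lambda>u. laplace_mean (cos (Complex (\<epsilon> * u) v)) (- \<i> * sin (Complex (\<epsilon> * u) v)))
     \<longlongrightarrow> integral {0..pi} (boundary_integrand \<epsilon> v) / of_real pi) (at_right 0)"
    by (simp only: laplace_mean_def h_def[abs_def])
  have "(\<lambda>k. inverse (real (Suc k))) \<longlonglongrightarrow> 0" by (rule LIMSEQ_inverse_real_of_nat)
  moreover have "inverse (real (Suc k)) \<in> {0<..<pi}" for k
  proof -
    have "inverse (real (Suc k)) \<le> 1" by (simp add: inverse_le_1_iff)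
    then show ?thesis using pi_gt3 by auto
  qed
  ultimately show "boundary_integrand \<epsilon> v integrable_on {0..pi}" using dom[of "\<lambda>k. inverse (real (Suc k))"] by blast
qed

definition exp_line_integral :: "real \<Rightarrow> real \<Rightarrow> complex" where
  "exp_line_integral \<sigma> \<rho> = (LINT \<nu>|lborel. b (Complex \<sigma> \<nu>) * exp (Complex \<sigma> \<nu> * of_real \<rho>))"

lemma exp_line_integral_eq:
  assumes "\<sigma> \<ge> -1/2" "\<sigma>' \<ge> -1/2"
  shows "exp_line_integral \<sigma> \<rho> = exp_line_integral \<sigma>' \<rho>"
  unfolding exp_line_integral_def
  using exp_line_integral_shift[OF assms(1)] exp_line_integral_shift[OF assms(2), symmetric]
  by (cases \<sigma> \<sigma>' rule: linorder_cases) blast+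

text \<open>
  Laplace's integral for the Legendre function and Fubini's theorem; the base of the power lies between
  e^(-v) and e^v, which makes the double integral absolutely convergent.
\<close>

lemma legendre_fn_line_integral:
  assumes \<sigma>: "\<sigma> \<ge> -1/2" and v: "0 \<le> v"
  shows "integrable lborel (\<lambda>\<nu>. b (Complex \<sigma> \<nu>) * legendre_fn (Complex \<sigma> \<nu>) (cosh v))"
    and "(LINT \<nu>|lborel. b (Complex \<sigma> \<nu>) * legendre_fn (Complex \<sigma> \<nu>) (cosh v))
       = integral {0..pi} (\<lambda>\<phi>. exp_line_integral \<sigma> (ln (cosh v + sinh v * cos \<phi>))) / of_real pi"
proof -
  define \<rho> where "\<rho> \<phi> = ln (cosh v + sinh v * cos \<phi>)" for \<phi> :: real
  have ctr: "continuous_on UNIV \<rho>"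
    unfolding \<rho>_def using cosh_add_sinh_cos_pos[of v] by (intro continuous_intros) (auto simp: less_imp_neq[symmetric])
  have bd: "\<bar>\<rho> \<phi>\<bar> \<le> v" for \<phi>
  proof -
    have "\<bar>sinh v * cos \<phi>\<bar> \<le> sinh v * 1" using v unfolding abs_mult by (intro mult_mono) auto
    then have "exp (- v) \<le> cosh v + sinh v * cos \<phi>" "cosh v + sinh v * cos \<phi> \<le> exp v"
      by (auto simp: cosh_minus_sinh[symmetric] cosh_plus_sinh[symmetric])
    then have "ln (exp (- v)) \<le> \<rho> \<phi>" "\<rho> \<phi> \<le> ln (exp v)"
      unfolding \<rho>_def using cosh_add_sinh_cos_pos[of v \<phi>] by (subst ln_le_cancel_iff; auto)+
    then show ?thesis by simp
  qed
  have sh: "sqrt ((cosh v)\<^sup>2 - 1) = sinh v" using v by (simp add: cosh_square_eq)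
  have leg: "legendre_fn z (cosh v) = integral {0..pi} (\<lambda>\<phi>. exp (z * of_real (\<rho> \<phi>))) / of_real pi" for z
  proof -
    have "complex_of_real (cosh v + sinh v * cos \<phi>) powr z = exp (z * of_real (\<rho> \<phi>))" for \<phi>
      using cosh_add_sinh_cos_pos[of v \<phi>] by (simp add: powr_def \<rho>_def Ln_of_real del: of_real_add of_real_mult)
    then show ?thesis by (simp add: legendre_fn_def sh)
  qed
  have leb: "integral {0..pi} f = (LINT \<phi>|lborel. indicator {0..pi} \<phi> *\<^sub>R f \<phi>)" if "continuous_on UNIV f" for f :: "real \<Rightarrow> complex"
  proof -
    have "set_integrable lborel {0..pi} f"
      unfolding set_integrable_def
      by (intro borel_integrable_compact) (auto intro: continuous_on_subset[OF that])
    then show ?thesis using set_borel_integral_eq_integral(2)[of "{0..pi}" f] by (simp add: set_lebesgue_integral_def)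
  qed
  define J where "J \<nu> \<phi> = indicator {0..pi} \<phi> *\<^sub>R (b (Complex \<sigma> \<nu>) * exp (Complex \<sigma> \<nu> * of_real (\<rho> \<phi>)))" for \<nu> \<phi>
  have cte: "continuous_on UNIV (\<lambda>\<phi>. exp (z * of_real (\<rho> \<phi>)))" for z :: complex
    by (intro continuous_intros ctr)
  have integrand: "b (Complex \<sigma> \<nu>) * legendre_fn (Complex \<sigma> \<nu>) (cosh v) = (LINT \<phi>|lborel. J \<nu> \<phi>) / of_real pi" for \<nu>
  proof -
    have "(LINT \<phi>|lborel. J \<nu> \<phi>) = b (Complex \<sigma> \<nu>) * (LINT \<phi>|lborel. indicator {0..pi} \<phi> *\<^sub>R exp (Complex \<sigma> \<nu> * of_real (\<rho> \<phi>)))"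
      unfolding J_def mult_scaleR_right[symmetric] by (rule integral_mult_right_zero)
    then show ?thesis unfolding leg by (simp add: leb[OF cte])
  qed
  have lc: "continuous_on UNIV (\<lambda>\<nu>. b (Complex \<sigma> \<nu>))" by (rule line_continuous[OF \<sigma>])
  have "continuous_on UNIV (\<lambda>p. b (Complex \<sigma> (fst p)) * exp (Complex \<sigma> (fst p) * of_real (\<rho> (snd p))))"
    unfolding Complex_eq
    by (intro continuous_intros continuous_on_compose2[OF lc[unfolded Complex_eq], of _ fst] continuous_on_compose2[OF ctr, of _ snd]) auto
  then have "(\<lambda>p. b (Complex \<sigma> (fst p)) * exp (Complex \<sigma> (fst p) * of_real (\<rho> (snd p)))) \<in> borel_measurable (borel :: (real \<times> real) measure)"
    by (rule borel_measurable_continuous_onI)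
  then have mE [measurable]: "(\<lambda>p. b (Complex \<sigma> (fst p)) * exp (Complex \<sigma> (fst p) * of_real (\<rho> (snd p)))) \<in> borel_measurable (lborel \<Otimes>\<^sub>M lborel)"
    by (simp add: lborel_prod)
  have meas: "case_prod J \<in> borel_measurable (lborel \<Otimes>\<^sub>M lborel)"
    unfolding J_def case_prod_unfold by measurable
  define E where "E = exp (\<bar>\<sigma>\<bar> * v)"
  have Jbd: "norm (J \<nu> \<phi>) \<le> indicator {0..pi} \<phi> * (E * cmod (b (Complex \<sigma> \<nu>)))" for \<nu> \<phi>
  proof -
    have "\<sigma> * \<rho> \<phi> \<le> \<bar>\<sigma>\<bar> * \<bar>\<rho> \<phi>\<bar>" by (metis abs_ge_self abs_mult)
    also have "\<dots> \<le> \<bar>\<sigma>\<bar> * v" using bd by (intro mult_left_mono) auto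
    finally have "exp (\<sigma> * \<rho> \<phi>) \<le> E" by (simp add: E_def)
    then show ?thesis by (auto simp: J_def norm_mult indicator_def mult.commute[of E] mult_left_mono)
  qed
  have int2: "integrable (lborel \<Otimes>\<^sub>M lborel) (case_prod J)"
    unfolding integrable_iff_bounded
  proof
    have meas_b: "(\<lambda>\<nu>. b (Complex \<sigma> \<nu>)) \<in> borel_measurable borel"
      by (rule borel_measurable_continuous_onI[OF lc])
    have E: "E \<ge> 0" by (simp add: E_def)
    have "(\<integral>\<^sup>+p. ennreal (norm (case_prod J p)) \<partial>(lborel \<Otimes>\<^sub>M lborel)) = (\<integral>\<^sup>+\<nu>. \<integral>\<^sup>+\<phi>. ennreal (norm (J \<nu> \<phi>)) \<partial>lborel \<partial>lborel)"
      using lborel.nn_integral_fst[of "\<lambda>p. ennreal (norm (case_prod J p))" lborel] meas by simp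
    also have "\<dots> \<le> (\<integral>\<^sup>+\<nu>. \<integral>\<^sup>+\<phi>. ennreal (E * cmod (b (Complex \<sigma> \<nu>))) * indicator {0..pi} \<phi> \<partial>lborel \<partial>lborel)"
    proof (intro nn_integral_mono)
      fix \<nu> \<phi>
      show "ennreal (norm (J \<nu> \<phi>)) \<le> ennreal (E * cmod (b (Complex \<sigma> \<nu>))) * indicator {0..pi} \<phi>"
        using Jbd[of \<nu> \<phi>] by (cases "\<phi> \<in> {0..pi}") (simp_all add: ennreal_leI)
    qed
    also have "\<dots> = (\<integral>\<^sup>+\<nu>. ennreal (pi * E) * ennreal (cmod (b (Complex \<sigma> \<nu>))) \<partial>lborel)"
      using E by (intro nn_integral_cong, subst nn_integral_cmult_indicator) (auto simp: ennreal_mult mult_ac)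
    also have "\<dots> = ennreal (pi * E) * (\<integral>\<^sup>+\<nu>. ennreal (cmod (b (Complex \<sigma> \<nu>))) \<partial>lborel)"
      using meas_b by (intro nn_integral_cmult) measurable
    also have "\<dots> \<le> ennreal (pi * E) * ennreal B" by (intro mult_left_mono bound \<sigma>) auto
    also have "\<dots> < \<infinity>" by (simp add: ennreal_mult_less_top)
    finally show "(\<integral>\<^sup>+p. ennreal (norm (case_prod J p)) \<partial>(lborel \<Otimes>\<^sub>M lborel)) < \<infinity>" .
  qed (rule meas)
  show "integrable lborel (\<lambda>\<nu>. b (Complex \<sigma> \<nu>) * legendre_fn (Complex \<sigma> \<nu>) (cosh v))"
    unfolding integrand using lborel_pair.integrable_fst'[OF int2] by simp
  have "(LINT \<nu>|lborel. b (Complex \<sigma> \<nu>) * legendre_fn (Complex \<sigma> \<nu>) (cosh v)) = (LINT \<nu>|lborel. LINT \<phi>|lborel. J \<nu> \<phi>) / of_real pi"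
    unfolding integrand by simp
  also have "(LINT \<nu>|lborel. LINT \<phi>|lborel. J \<nu> \<phi>) = (LINT \<phi>|lborel. LINT \<nu>|lborel. J \<nu> \<phi>)"
    by (rule lborel_pair.Fubini_integral[OF int2, symmetric])
  also have "(\<lambda>\<phi>. LINT \<nu>|lborel. J \<nu> \<phi>) = (\<lambda>\<phi>. indicator {0..pi} \<phi> *\<^sub>R exp_line_integral \<sigma> (\<rho> \<phi>))"
    by (simp add: J_def exp_line_integral_def)
  also have "(LINT \<phi>|lborel. indicator {0..pi} \<phi> *\<^sub>R exp_line_integral \<sigma> (\<rho> \<phi>)) = integral {0..pi} (\<lambda>\<phi>. exp_line_integral \<sigma> (\<rho> \<phi>))"
  proof -
    have "integrable lborel (\<lambda>\<phi>. LINT \<nu>|lborel. J \<nu> \<phi>)"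
      using lborel_pair.integrable_snd[OF int2] .
    then have "set_integrable lborel {0..pi} (\<lambda>\<phi>. exp_line_integral \<sigma> (\<rho> \<phi>))"
      by (simp add: J_def exp_line_integral_def set_integrable_def)
    from set_borel_integral_eq_integral(2)[OF this] show ?thesis by (simp add: set_lebesgue_integral_def)
  qed
  finally show "(LINT \<nu>|lborel. b (Complex \<sigma> \<nu>) * legendre_fn (Complex \<sigma> \<nu>) (cosh v))
       = integral {0..pi} (\<lambda>\<phi>. exp_line_integral \<sigma> (ln (cosh v + sinh v * cos \<phi>))) / of_real pi"
    by (simp add: \<rho>_def)
qed

text \<open>
  The jump of the continued power series is known at every point of Laplace's path, and averaging it along
  the path gives the jump of the Laplace mean. Any line Re \<lambda> = \<sigma> \<ge> -1/2 may be used because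
  the inverse Mellin integrals do not depend on it.
\<close>

lemma jump_eq_line_integral:
  assumes \<sigma>: "\<sigma> \<ge> -1/2" and v: "0 \<le> v"
  shows "\<i> * (integral {0..pi} (boundary_integrand 1 v) / of_real pi - integral {0..pi} (boundary_integrand (-1) v) / of_real pi)
    = (LINT \<nu>|lborel. b (Complex \<sigma> \<nu>) * legendre_fn (Complex \<sigma> \<nu>) (cosh v))"
proof -
  have "integral {0..pi} (boundary_integrand 1 v) - integral {0..pi} (boundary_integrand (-1) v)
     = integral {0..pi} (\<lambda>\<phi>. boundary_integrand 1 v \<phi> - boundary_integrand (-1) v \<phi>)"
    using v by (intro integral_diff[symmetric] laplace_mean_boundary_limit) auto
  also have "\<dots> = integral {0..pi} (\<lambda>\<phi>. - \<i> * exp_line_integral \<sigma> (ln (cosh v + sinh v * cos \<phi>)))"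
    using mb_jump exp_line_integral_eq[OF \<sigma>, of "-1/4"]
    by (simp add: boundary_integrand_def) (simp add: exp_line_integral_def)
  also have "\<dots> = - \<i> * integral {0..pi} (\<lambda>\<phi>. exp_line_integral \<sigma> (ln (cosh v + sinh v * cos \<phi>)))"
    by (rule integral_mult_right)
  finally show ?thesis
    unfolding legendre_fn_line_integral(2)[OF assms] diff_divide_distrib[symmetric] by simp
qed

end

section \<open>The jump function of the Legendre expansion\<close>

text \<open>
  The identity theorem on the connected cut plane: the expansion prescribes the values on (0, 1), which
  accumulate at the origin.
\<close>

lemma legendre_extension_unique:
  assumes g: "legendre_extension a g" and g': "legendre_extension a g'" and z: "z \<in> cut_plane"
  shows "g z = g' z"
proof -
  let ?U = "complex_of_real ` {0<..<1}"
  have on_U: "g w - g' w = 0" if "w \<in> ?U" for w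
  proof -
    from that obtain x where x: "w = of_real x" "0 < x" "x < 1" by auto
    then have "\<bar>cos (arccos x)\<bar> < 1" "w = of_real (cos (arccos x))" by auto
    then show ?thesis
      using g g' sums_unique2 unfolding legendre_extension_def by fastforce
  qed
  have "(\<lambda>n. complex_of_real (inverse (real (Suc (Suc n))))) \<longlonglongrightarrow> of_real 0"
    using LIMSEQ_Suc[OF LIMSEQ_inverse_real_of_nat] by (intro tendsto_of_real)
  moreover have "complex_of_real (inverse (real (Suc (Suc n)))) \<in> ?U - {0}" for n
    by (intro DiffI imageI) (auto simp: inverse_less_1_iff simp del: of_nat_Suc)
  ultimately have lim: "0 islimpt ?U"
    unfolding islimpt_sequential by (auto intro!: exI[of _ "\<lambda>n. complex_of_real (inverse (real (Suc (Suc n))))"])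
  have "g z - g' z = 0"
  proof (rule analytic_continuation[where S = cut_plane and U = ?U and \<xi> = 0 and f = "\<lambda>w. g w - g' w"])
    show "(\<lambda>w. g w - g' w) holomorphic_on cut_plane"
      using g g' by (auto simp: legendre_extension_def intro!: holomorphic_intros)
    show "?U \<subseteq> cut_plane" by (auto simp: in_cut_plane_iff)
  qed (use lim z on_U open_cut_plane connected_cut_plane in \<open>auto simp: in_cut_plane_iff\<close>)
  then show ?thesis by simp
qed

theorem proposition8:
  fixes p :: nat and a f :: "nat \<Rightarrow> real" and A :: "complex \<Rightarrow> complex"
  assumes p: "p \<ge> 2"
    and f: "\<And>n. f n = real n ^ p * a n"
    and hausdorff: "hausdorff_condition f"
    and interp: "carlsonian_interpolation p a A"
  shows "(\<exists>g. legendre_extension a g) \<and>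
    (\<forall>g. legendre_extension a g \<longrightarrow>
      (\<forall>v\<ge>0.
        ((\<lambda>u. g (cos (Complex u v))) \<longlongrightarrow> boundary_plus g v) (at_right 0) \<and>
        ((\<lambda>u. g (cos (Complex (- u) v))) \<longlongrightarrow> boundary_minus g v) (at_right 0) \<and>
        (\<forall>\<sigma>\<ge>-1/2.
          integrable lborel (\<lambda>\<nu>. A (Complex \<sigma> \<nu>) * (2 * Complex \<sigma> \<nu> + 1)
            * legendre_fn (Complex \<sigma> \<nu>) (cosh v)) \<and>
          jump_function g v =
            1 / (4 * of_real pi) *
              (LINT \<nu>|lborel. A (Complex \<sigma> \<nu>) * (2 * Complex \<sigma> \<nu> + 1)
                * legendre_fn (Complex \<sigma> \<nu>) (cosh v)))))"
proof -
  define b where "b z = (2 * z + 1) * A z / (4 * of_real pi)" for z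
  have b_node: "b (of_nat n) = of_real (1 / (4 * pi) * (real (2 * n + 1) * a n))" for n
    using interp by (simp add: b_def carlsonian_interpolation_def)
  obtain B where B: "B \<ge> 0" "\<And>\<sigma>. \<sigma> \<ge> -1/2 \<Longrightarrow>
    (\<integral>\<^sup>+\<nu>. ennreal (cmod ((2 * Complex \<sigma> \<nu> + 1) * A (Complex \<sigma> \<nu>))) \<partial>lborel) \<le> ennreal B"
    using hardy_line_bound[OF interp p] by blast
  interpret summable_line_integrable b B
  proof
    show "b holomorphic_on {z. Re z > -1/2}"
      using interp unfolding b_def carlsonian_interpolation_def by (auto intro!: holomorphic_intros)
    show "continuous_on {z. Re z \<ge> -1/2} b"
      using interp unfolding b_def carlsonian_interpolation_def by (auto intro!: continuous_intros)
    show "B \<ge> 0" by (rule B)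
    show "(\<integral>\<^sup>+\<nu>. ennreal (cmod (b (Complex \<sigma> \<nu>))) \<partial>lborel) \<le> ennreal B" if "\<sigma> \<ge> -1/2" for \<sigma>
    proof -
      have "(\<integral>\<^sup>+\<nu>. ennreal (cmod (b (Complex \<sigma> \<nu>))) \<partial>lborel) \<le>
         (\<integral>\<^sup>+\<nu>. ennreal (cmod ((2 * Complex \<sigma> \<nu> + 1) * A (Complex \<sigma> \<nu>))) \<partial>lborel)"
      proof (intro nn_integral_mono ennreal_leI)
        fix \<nu>
        have "x / (4 * pi) \<le> x / 1" if "x \<ge> 0" for x :: real
          using that pi_gt3 by (intro divide_left_mono) auto
        then show "cmod (b (Complex \<sigma> \<nu>)) \<le> cmod ((2 * Complex \<sigma> \<nu> + 1) * A (Complex \<sigma> \<nu>))"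
          unfolding b_def by (simp add: norm_divide norm_mult)
      qed
      also have "\<dots> \<le> ennreal B" by (rule B(2)[OF that])
      finally show ?thesis .
    qed
    have "summable (\<lambda>n. 1 / (4 * pi) * \<bar>real (2 * n + 1) * a n\<bar>)"
      by (intro summable_mult hausdorff_summable[OF hausdorff f p])
    then show "summable (\<lambda>n. cmod (b (of_nat n)))"
      unfolding b_node norm_of_real by (simp add: abs_mult)
  qed
  obtain g0 where g0: "g0 holomorphic_on cut_plane"
    "\<And>z s. z \<in> cut_plane \<Longrightarrow> z \<noteq> -1 \<Longrightarrow> s\<^sup>2 = z\<^sup>2 - 1 \<Longrightarrow> g0 z = laplace_mean z s"
    using laplace_mean_extension by blast
  have ext: "legendre_extension a g0"
    unfolding legendre_extension_def
  proof (intro conjI allI impI g0(1))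
    fix u :: real assume u: "\<bar>cos u\<bar> < 1"
    define s where "s = csqrt (of_real ((cos u)\<^sup>2 - 1))"
    have "(\<lambda>n. b (of_nat n) * of_real (poly (legendre_poly n) (cos u))) sums laplace_mean (of_real (cos u)) s"
      by (rule legendre_series_sums_laplace_mean[OF u]) (simp add: s_def)
    also have "laplace_mean (of_real (cos u)) s = g0 (of_real (cos u))"
    proof (rule g0(2)[symmetric])
      show "complex_of_real (cos u) \<in> cut_plane" using u by (auto simp: in_cut_plane_iff)
      show "complex_of_real (cos u) \<noteq> -1" using u by (auto simp: complex_eq_iff)
    qed (simp add: s_def)
    finally show "(\<lambda>n. complex_of_real (1 / (4 * pi) * (real (2 * n + 1) * a n * poly (legendre_poly n) (cos u)))) sums g0 (of_real (cos u))"
      unfolding b_node by (simp add: mult_ac)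
  qed
  have limit: "((\<lambda>u. g (cos (Complex (\<epsilon> * u) v))) \<longlongrightarrow> integral {0..pi} (boundary_integrand \<epsilon> v) / of_real pi) (at_right 0)"
    if g: "legendre_extension a g" and v: "v \<ge> 0" and \<epsilon>: "\<epsilon> = 1 \<or> \<epsilon> = -1" for g v \<epsilon>
  proof (rule Lim_transform_eventually[OF laplace_mean_boundary_limit(1)[OF \<epsilon> v]])
    have "\<forall>\<^sub>F u in at_right (0::real). u \<in> {0<..<pi}"
      using eventually_at_right_real[OF pi_gt_zero] .
    then show "\<forall>\<^sub>F u in at_right 0. laplace_mean (cos (Complex (\<epsilon> * u) v)) (- \<i> * sin (Complex (\<epsilon> * u) v)) = g (cos (Complex (\<epsilon> * u) v))"
    proof eventually_elim
      case (elim u)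
      then have u: "0 < sin u" "cos u < 1" "- 1 < cos u"
        using sin_gt_zero[of u] cos_monotone_0_pi[of 0 u] cos_monotone_0_pi[of u pi] by auto
      have "cos (Complex (\<epsilon> * u) v) \<in> cut_plane \<and> cos (Complex (\<epsilon> * u) v) \<noteq> -1"
        using u v \<epsilon> by (cases "v = 0") (auto simp: in_cut_plane_iff cos_Complex complex_eq_iff)
      then show ?case
        using g0(2) legendre_extension_unique[OF g ext] minus_i_sin_squared by metis
    qed
  qed
  show ?thesis
  proof (intro conjI allI impI)
    show "\<exists>g. legendre_extension a g" using ext by blast
    fix g v assume g: "legendre_extension a g" and v: "(0::real) \<le> v"
    have plus: "((\<lambda>u. g (cos (Complex u v))) \<longlongrightarrow> integral {0..pi} (boundary_integrand 1 v) / of_real pi) (at_right 0)"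
      using limit[OF g v, of 1] by simp
    have minus: "((\<lambda>u. g (cos (Complex (- u) v))) \<longlongrightarrow> integral {0..pi} (boundary_integrand (-1) v) / of_real pi) (at_right 0)"
      using limit[OF g v, of "-1"] by simp
    have bp: "boundary_plus g v = integral {0..pi} (boundary_integrand 1 v) / of_real pi"
      unfolding boundary_plus_def by (rule tendsto_Lim[OF _ plus]) simp
    have bm: "boundary_minus g v = integral {0..pi} (boundary_integrand (-1) v) / of_real pi"
      unfolding boundary_minus_def by (rule tendsto_Lim[OF _ minus]) simp
    show "((\<lambda>u. g (cos (Complex u v))) \<longlongrightarrow> boundary_plus g v) (at_right 0)"
      unfolding bp by (rule plus)
    show "((\<lambda>u. g (cos (Complex (- u) v))) \<longlongrightarrow> boundary_minus g v) (at_right 0)"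
      unfolding bm by (rule minus)
    fix \<sigma> :: real assume \<sigma>: "-1/2 \<le> \<sigma>"
    have integrand: "A (Complex \<sigma> \<nu>) * (2 * Complex \<sigma> \<nu> + 1) * legendre_fn (Complex \<sigma> \<nu>) (cosh v)
       = 4 * of_real pi * (b (Complex \<sigma> \<nu>) * legendre_fn (Complex \<sigma> \<nu>) (cosh v))" for \<nu>
      by (simp add: b_def)
    show "integrable lborel (\<lambda>\<nu>. A (Complex \<sigma> \<nu>) * (2 * Complex \<sigma> \<nu> + 1) * legendre_fn (Complex \<sigma> \<nu>) (cosh v))"
      unfolding integrand by (intro integrable_mult_right legendre_fn_line_integral(1) \<sigma> v)
    show "jump_function g v = 1 / (4 * of_real pi) * (LINT \<nu>|lborel. A (Complex \<sigma> \<nu>) * (2 * Complex \<sigma> \<nu> + 1) * legendre_fn (Complex \<sigma> \<nu>) (cosh v))"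
      unfolding jump_function_def bp bm jump_eq_line_integral[OF \<sigma> v] integrand by simp
  qed
qed

end
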